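(* Fix $p>1$ and let $\mathcal{P}$ be a class of atom-free probability distributions on $\mathbb{R}$ with finite $p$-th moment. Let $w$ satisfy $\sup_{t\ge 0} t\,w(t)<\infty$ and $w(t)\ge (1-t^p)_+$ for all $t\ge 0$. Let $X_{1:n}\sim P^{\otimes n}$ with $P\in\mathcal{P}$, and let the base estimator $\widehat{\kappa}$ be a real random variable independent of $X_{1:n}$. Let $\varepsilon\in[0,\frac12)$, $\delta\in(0,1)$, $\xi>0$, and set $\eta=\ln\frac4\delta+(1+\xi)\varepsilon n$. Assume $$(1+2\xi)\varepsilon+\frac{\overline{c}}{n}\ln\frac{4}{\delta}<1,\qquad \overline{c}=16+4\xi^{-1}.$$ Let $\widehat{\mu}^{\varepsilon}=\widehat{\mu}(\widehat{\kappa};X_{1:n}^{\varepsilon})$ and $R_{\widehat\kappa}=R_{\widehat{\kappa}}\left(\frac{\delta}{4}\right)$. Then there is a constant $C_{w,\xi}>0$ depending only on $w$ and $\xi$ such that, with probability at least $1-\delta$, for all $X_{1:n}^{\varepsilon}\in\mathcal{A}(X_{1:n},\varepsilon)$, $|\widehat{\mu}^{\varepsilon}-\mu|$ is at most $$C_{w,\xi}\left\{\inf_{1<q\le 2\wedge p}\left(\nu_q+\nu_q^{\frac q2}R_{\widehat\kappa}^{1-\frac q2}\right)\left(\frac1n\ln\frac4\delta\right)^{1-\frac1q}+\inf_{1<q\le p}\left(\nu_q+R_{\widehat\kappa}\right)\left(\frac1n\ln\frac4\delta+\varepsilon\right)^{1-\frac1q}\right\}.$$ In particular, if there exist constants $C,\delta_{\min}>0$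 depending only on the base estimator such that $R_{\widehat\kappa}\left(\frac\delta4\right)\le C\nu_p$ for all $\delta\ge\delta_{\min}$ and all $P\in\mathcal{P}$, then for $\delta\ge\delta_{\min}\vee 4e^{-\frac{1-(1+2\xi)\varepsilon}{\overline c}n}$, $$\mathbb{P}\left[\sup_{X_{1:n}^{\varepsilon}\in\mathcal{A}(X_{1:n},\varepsilon)}|\widehat\mu^{\varepsilon}-\mu|>\tilde C_{w,\xi}\left\{\nu_{2\wedge p}\left(\frac1n\ln\frac4\delta\right)^{1-\frac{1}{2\wedge p}}+\nu_p\,\varepsilon^{1-\frac1p}\right\}\right]\le\delta,$$ where $\tilde C_{w,\xi}=C_{w,\xi}(2C+3)$.
   Context: Throughout, $w:[0,\infty)\to[0,1]$ is right-continuous and non-increasing with $w(0)=1$ and $\lim_{t\to\infty}w(t)=0$. For $X\sim P$: $\mu=\mathbb{E}X$ and $\nu_q=(\mathbb{E}|X-\mu|^q)^{1/q}$. $X_{1:n}=(X_1,\dots,X_n)$ is an i.i.d. sample, and the set of $\varepsilon$-contaminated versions is $\mathcal{A}(X_{1:n},\varepsilon)=\{Y_{1:n}\in\mathbb{R}^n:\#\{i:X_i\neq Y_i\}\le n\varepsilon\}$. For a sample $x_{1:n}$, $\kappa\in\mathbb{R}$ and shrinkage level $\eta\in(0,n)$ define $$\widehat\alpha(\kappa;x_{1:n})=\inf\Big\{\alpha>0:\sum_{i=1}^n w(\alpha|x_i-\kappa|)\le n-\eta\Big\},$$ $$\widehat\mu(\kappa;x_{1:n})=\kappa+\frac1n\sum_{i=1}^n(x_i-\kappa)\,w\big(\widehat\alpha(\kappa;x_{1:n})|x_i-\kappa|\big).$$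 The quantile of the error of $\widehat\kappa$ is $R_{\widehat\kappa}(\delta)=\inf\{r>0:\mathbb{P}[|\widehat\kappa-\mu|>r]\le\delta\}$. Notation: $a\wedge b=\min(a,b)$, $a\vee b=\max(a,b)$, $x_+=\max(x,0)$.
   Formalization: In the "in particular" part, the bound R(δ/4) ≤ Cν_p is assumed with the same C for every ν_q, 2∧p ≤ q ≤ p (for p > 2 this adds R ≤ Cν_2); as written the claim fails for p > 2, e.g. a constant base estimator equal to ν_3 with ν_3 much larger than ν_2. *)

theory Defs
  imports "HOL-Probability.Probability"
begin

definition weight_fun :: "(real \<Rightarrow> real) \<Rightarrow> bool" where
  "weight_fun w \<longleftrightarrow>
     (\<forall>t\<ge>0. 0 \<le> w t \<and> w t \<le> 1) \<and>
     (\<forall>t\<ge>0. continuous (at_right t) w) \<and>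
     (\<forall>s t. 0 \<le> s \<longrightarrow> s \<le> t \<longrightarrow> w t \<le> w s) \<and>
     w 0 = 1 \<and> (w \<longlongrightarrow> 0) at_top"

(* The infimum defining alpha_hat may be over the empty set (many corrupted points may coincide
   with kappa), so it is taken in ereal, where Inf {} = \<infinity>, and w is extended by its limit
   w(\<infinity>) = 0. In ereal, \<infinity> * 0 = 0. *)
definition weight_ext :: "(real \<Rightarrow> real) \<Rightarrow> ereal \<Rightarrow> real" where
  "weight_ext w t = (if t = \<infinity> then 0 else w (real_of_ereal t))"

(* A sample of size n is a function x on nat of which only x 0, ..., x (n - 1) matter. *)
definition alpha_hat :: "(real \<Rightarrow> real) \<Rightarrow> real \<Rightarrow> nat \<Rightarrow> real \<Rightarrow> (nat \<Rightarrow> real) \<Rightarrow> ereal" where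
  "alpha_hat w \<eta> n \<kappa> x =
     Inf {ereal a | a. a > 0 \<and> (\<Sum>i<n. w (a * \<bar>x i - \<kappa>\<bar>)) \<le> real n - \<eta>}"

definition mu_hat :: "(real \<Rightarrow> real) \<Rightarrow> real \<Rightarrow> nat \<Rightarrow> real \<Rightarrow> (nat \<Rightarrow> real) \<Rightarrow> real" where
  "mu_hat w \<eta> n \<kappa> x =
     \<kappa> + 1 / real n *
       (\<Sum>i<n. (x i - \<kappa>) * weight_ext w (alpha_hat w \<eta> n \<kappa> x * ereal \<bar>x i - \<kappa>\<bar>))"

definition contaminated :: "nat \<Rightarrow> real \<Rightarrow> (nat \<Rightarrow> real) \<Rightarrow> (nat \<Rightarrow> real) set" where
  "contaminated n \<epsilon> x = {y. real (card {i. i < n \<and> x i \<noteq> y i}) \<le> real n * \<epsilon>}"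

definition mean :: "real measure \<Rightarrow> real" where
  "mean P = (\<integral>x. x \<partial>P)"

definition nu :: "real measure \<Rightarrow> real \<Rightarrow> real" where
  "nu P q = (\<integral>x. \<bar>x - mean P\<bar> powr q \<partial>P) powr (1 / q)"

definition atom_free_moment :: "real \<Rightarrow> real measure \<Rightarrow> bool" where
  "atom_free_moment p P \<longleftrightarrow>
     prob_space P \<and> sets P = sets borel \<and> (\<forall>x. measure P {x} = 0) \<and>
     integrable P (\<lambda>x. \<bar>x\<bar> powr p)"

definition iid_sample :: "'a measure \<Rightarrow> real measure \<Rightarrow> nat \<Rightarrow> (nat \<Rightarrow> 'a \<Rightarrow> real) \<Rightarrow> bool" where
  "iid_sample M P n X \<longleftrightarrow>
     prob_space.indep_vars M (\<lambda>_. borel) X {..<n} \<and> (\<forall>i<n. distr M borel (X i) = P)"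

definition indep_of_sample :: "'a measure \<Rightarrow> nat \<Rightarrow> ('a \<Rightarrow> real) \<Rightarrow> (nat \<Rightarrow> 'a \<Rightarrow> real) \<Rightarrow> bool" where
  "indep_of_sample M n \<kappa> X \<longleftrightarrow>
     \<kappa> \<in> borel_measurable M \<and>
     prob_space.indep_set M
       {\<kappa> -` A \<inter> space M | A. A \<in> sets borel}
       {(\<lambda>\<omega>. \<lambda>i\<in>{..<n}. X i \<omega>) -` B \<inter> space M | B. B \<in> sets (\<Pi>\<^sub>M i\<in>{..<n}. borel)}"

definition err_quantile :: "'a measure \<Rightarrow> ('a \<Rightarrow> real) \<Rightarrow> real \<Rightarrow> real \<Rightarrow> real" where
  "err_quantile M \<kappa> m \<delta> =
     Inf {r. r > 0 \<and> measure M {\<omega> \<in> space M. \<bar>\<kappa> \<omega> - m\<bar> > r} \<le> \<delta>}"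

(* Power with 0^0 = 1, whereas 0 powr 0 = 0; needed for R^(1 - q/2) at q = 2, R = 0. *)
definition rpow :: "real \<Rightarrow> real \<Rightarrow> real" where
  "rpow x a = (if a = 0 then 1 else x powr a)"

definition c_bar :: "real \<Rightarrow> real" where
  "c_bar \<xi> = 16 + 4 / \<xi>"

definition err_bound :: "real measure \<Rightarrow> real \<Rightarrow> real \<Rightarrow> real \<Rightarrow> nat \<Rightarrow> real \<Rightarrow> real" where
  "err_bound P p R \<epsilon> n \<delta> =
     (INF q\<in>{1<..min 2 p}.
        (nu P q + nu P q powr (q / 2) * rpow R (1 - q / 2)) *
        (1 / real n * ln (4 / \<delta>)) powr (1 - 1 / q)) +
     (INF q\<in>{1<..p}. (nu P q + R) * (1 / real n * ln (4 / \<delta>) + \<epsilon>) powr (1 - 1 / q))"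

(* Events involving all contaminated samples are uncountable intersections or unions, so
   probability bounds for them are stated through a measurable event inside or around them;
   for a measurable event this is the ordinary probability bound. *)
definition prob_at_least :: "'a measure \<Rightarrow> real \<Rightarrow> ('a \<Rightarrow> bool) \<Rightarrow> bool" where
  "prob_at_least M a Q \<longleftrightarrow> (\<exists>E\<in>sets M. E \<subseteq> {\<omega> \<in> space M. Q \<omega>} \<and> measure M E \<ge> a)"

definition prob_at_most :: "'a measure \<Rightarrow> real \<Rightarrow> ('a \<Rightarrow> bool) \<Rightarrow> bool" where
  "prob_at_most M b Q \<longleftrightarrow> (\<exists>E\<in>sets M. {\<omega> \<in> space M. Q \<omega>} \<subseteq> E \<and> measure M E \<le> b)"

end

theory Submission
  imports Defs
begin

text \<open>
  Condition on the base estimate \<open>\<kappa>\<close> and put \<open>G \<kappa> a = E(1 - w(a|X - \<kappa>|))\<close>. As \<open>P\<close> is atom-free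
  and \<open>w\<close> has only countably many jumps, \<open>G \<kappa>\<close> is continuous and attains prescribed values.
  Chernoff bounds at two such deterministic levels trap \<open>alpha_hat\<close> between them, simultaneously
  for all contaminated samples. Since \<open>t w(t) \<le> K\<close>, each corrupted point then contributes at most
  \<open>K / a\<close>, where \<open>a\<close> is the lower level, and moving \<open>alpha_hat\<close> to \<open>a\<close> costs \<open>K / a\<close> times the mean
  deficit \<open>1 - w\<close> at the upper level. At the fixed level \<open>a\<close> the estimator is an i.i.d. average, to
  which Bernstein's inequality applies. The inequality \<open>1 - w(t) \<le> t\<^sup>q\<close> turns \<open>G \<kappa> a\<close> into an upper
  bound on \<open>1 / a\<close> by central moments. When the contamination is so large that no upper level
  exists, the trivial bound \<open>K / a + |\<kappa> - \<mu>|\<close> has the right order. Independence and Fubini finally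
  remove the conditioning on \<open>\<kappa>\<close>.
\<close>

section \<open>Elementary and measure-theoretic preliminaries\<close>

text \<open>The obstacle is that \<open>alpha_hat\<close> depends on the adversary's whole sample,
  so no concentration inequality applies directly to the weights in use. The event
  \<open>good_sample\<close> therefore speaks only of \<kappa> and the clean sample. Neither a
  contaminated sample nor a moment order enters it, so uniformity over contaminations and over the
  orders \<open>q\<close>, \<open>q'\<close> costs no probability. Put L = ln (4 / \<delta>).
  Altering at most n \<epsilon> points moves a sum of deficits by at most n \<epsilon>, which is why
  the two thresholds are t = \<eta> - n \<epsilon> and s = \<eta> + n \<epsilon>. The slack \<xi> in
  \<eta> leaves \<xi> \<epsilon> n inside t, so that t / n is comparable with D = L / n + \<epsilon>
  and the cost \<epsilon> / a of the corrupted points gets the rate D^(1 - 1/q). With t = L alone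
  the bound on 1 / a would be of order (L / n)^(-1/q), too large when \<epsilon> dominates.\<close>

lemma exp_mult_le_chord:
  fixes c f :: real
  assumes "0 \<le> f" "f \<le> 1"
  shows "exp (c * f) \<le> 1 + (exp c - 1) * f"
proof -
  have "exp ((1 - f) *\<^sub>R 0 + f *\<^sub>R c) \<le> (1 - f) * exp 0 + f * exp c"
    by (rule convex_onD[OF exp_convex]) (use assms in auto)
  then show ?thesis by (simp add: algebra_simps)
qed

lemma exp_le_one_plus_square:
  fixes y :: real
  assumes "\<bar>y\<bar> \<le> 1"
  shows "exp y \<le> 1 + y + y\<^sup>2"
proof (cases "0 \<le> y")
  case True
  then show ?thesis using assms exp_bound[of y] by auto
next
  case False
  define z where "z = - y"
  have z: "0 < z" "z \<le> 1" using False assms by (auto simp: z_def)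
  \<comment> \<open>The product equals 1 + z^3.\<close>
  have "1 \<le> (1 - z + z\<^sup>2) * (1 + z)"
    using z by (simp add: power2_eq_square algebra_simps)
  also have "\<dots> \<le> (1 - z + z\<^sup>2) * exp z"
    using z by (intro mult_left_mono exp_ge_add_one_self) auto
  finally have "exp (- z) \<le> 1 - z + z\<^sup>2"
    by (simp add: exp_minus field_simps)
  then show ?thesis by (simp add: z_def)
qed

text \<open>Markov's inequality for the exponential of the sum. The rate is built into
  \<open>h\<close>, so that positive and negative rates need no separate versions.\<close>

lemma chernoff_PiM:
  fixes h :: "'b \<Rightarrow> real"
  assumes "prob_space P" and h[measurable]: "h \<in> borel_measurable P"
    and bound: "\<And>x. x \<in> space P \<Longrightarrow> \<bar>h x\<bar> \<le> B"
    and mgf: "(\<integral>x. exp (h x) \<partial>P) \<le> exp c"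
  shows "measure (PiM {..<n} (\<lambda>_. P)) {x \<in> space (PiM {..<n} (\<lambda>_. P)). t \<le> (\<Sum>i<n. h (x i))}
    \<le> exp (real n * c - t)"
proof -
  interpret P: prob_space P by fact
  interpret Q: product_prob_space "\<lambda>_. P" "{..<n}" by unfold_locales
  let ?Q = "PiM {..<n} (\<lambda>_. P)"
  have int: "integrable P (\<lambda>x. exp (h x))"
    by (rule P.integrable_const_bound[where B = "exp B"]) (use bound in \<open>auto intro!: AE_I2 intro: order.trans[OF abs_ge_self]\<close>)
  have iQ: "integrable ?Q (\<lambda>x. \<Prod>i<n. exp (h (x i)))"
    by (rule Q.product_integrable_prod) (use int in auto)
  have "measure ?Q {x \<in> space ?Q. t \<le> (\<Sum>i<n. h (x i))}
      = measure ?Q {x \<in> space ?Q. exp t \<le> (\<Prod>i<n. exp (h (x i)))}"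
    by (simp add: exp_sum[symmetric])
  also have "\<dots> \<le> (\<integral>x. (\<Prod>i<n. exp (h (x i))) \<partial>?Q) / exp t"
    by (rule integral_Markov_inequality_measure[OF iQ]) (auto intro!: prod_nonneg)
  also have "(\<integral>x. (\<Prod>i<n. exp (h (x i))) \<partial>?Q) = (\<integral>x. exp (h x) \<partial>P) ^ n"
    by (subst Q.product_integral_prod) (use int in auto)
  also have "\<dots> / exp t \<le> exp c ^ n / exp t"
    by (intro divide_right_mono power_mono mgf integral_nonneg_AE) auto
  also have "\<dots> = exp (real n * c - t)"
    by (simp add: exp_diff exp_of_nat_mult)
  finally show ?thesis .
qed

lemma countable_discontinuities_antimono:
  fixes f :: "real \<Rightarrow> real"
  assumes "antimono f"
  shows "countable {x. \<not> isCont f x}"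
proof -
  have "mono (\<lambda>x. - f x)"
    using assms by (auto simp: mono_def antimono_def)
  then have "countable {x. \<not> isCont (\<lambda>x. - f x) x}"
    by (rule mono_ctble_discont)
  also have "{x. \<not> isCont (\<lambda>x. - f x) x} = {x. \<not> isCont f x}"
  proof -
    have "isCont (\<lambda>x. - f x) x \<longleftrightarrow> isCont f x" for x
      using continuous_minus[of "at x" f] continuous_minus[of "at x" "\<lambda>x. - f x"] by auto
    then show ?thesis by simp
  qed
  finally show ?thesis .
qed

lemma borel_measurable_antimono:
  fixes f :: "real \<Rightarrow> real"
  assumes "antimono f"
  shows "f \<in> borel_measurable borel"
proof -
  have "(\<lambda>x. - f x) \<in> borel_measurable borel"
    using assms by (intro borel_measurable_mono) (auto simp: mono_def antimono_def)
  then show ?thesis by simp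
qed

text \<open>Tail probabilities with a strict inequality are right-continuous in the threshold, so
  the bound survives at the infimum itself, even when that infimum is 0. The infimum is over a
  non-empty set because the tails of a real random variable vanish.\<close>

lemma err_quantile_nonneg_tail:
  assumes "prob_space M" and [measurable]: "\<kappa> \<in> borel_measurable M" and "\<delta> > 0"
  shows "0 \<le> err_quantile M \<kappa> m \<delta>"
    and "measure M {\<omega> \<in> space M. \<bar>\<kappa> \<omega> - m\<bar> > err_quantile M \<kappa> m \<delta>} \<le> \<delta>"
proof -
  interpret prob_space M by fact
  define S where "S = {r. r > 0 \<and> measure M {\<omega> \<in> space M. \<bar>\<kappa> \<omega> - m\<bar> > r} \<le> \<delta>}"
  define R where "R = err_quantile M \<kappa> m \<delta>"
  have R: "R = Inf S" by (simp add: R_def err_quantile_def S_def)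
  have bdd: "bdd_below S" by (rule bdd_belowI[of _ 0]) (auto simp: S_def)
  have "(\<lambda>k. measure M {\<omega> \<in> space M. \<bar>\<kappa> \<omega> - m\<bar> > real k}) \<longlonglongrightarrow> measure M (\<Inter>k. {\<omega> \<in> space M. \<bar>\<kappa> \<omega> - m\<bar> > real k})"
    by (rule finite_Lim_measure_decseq) (auto simp: decseq_def)
  also have "(\<Inter>k. {\<omega> \<in> space M. \<bar>\<kappa> \<omega> - m\<bar> > real k}) = {}"
  proof -
    have "\<exists>k. \<not> \<bar>\<kappa> \<omega> - m\<bar> > real k" for \<omega>
      using real_arch_simple[of "\<bar>\<kappa> \<omega> - m\<bar>"] by (auto simp: not_less)
    then show ?thesis by blast
  qed
  finally have "eventually (\<lambda>k. measure M {\<omega> \<in> space M. \<bar>\<kappa> \<omega> - m\<bar> > real k} < \<delta>) sequentially"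
    using assms(3) by (auto intro: order_tendstoD(2))
  then obtain N where N: "\<And>k. k \<ge> N \<Longrightarrow> measure M {\<omega> \<in> space M. \<bar>\<kappa> \<omega> - m\<bar> > real k} < \<delta>"
    by (auto simp: eventually_sequentially)
  have ne: "S \<noteq> {}"
  proof -
    have "real (Suc N) \<in> S"
      using N[of "Suc N"] unfolding S_def by (simp add: less_imp_le)
    then show ?thesis by blast
  qed
  show "0 \<le> err_quantile M \<kappa> m \<delta>"
    unfolding R_def[symmetric] R by (rule cInf_greatest[OF ne]) (auto simp: S_def)
  have step: "measure M {\<omega> \<in> space M. \<bar>\<kappa> \<omega> - m\<bar> > R + inverse (real (Suc k))} \<le> \<delta>" for k
  proof -
    have "Inf S < R + inverse (real (Suc k))" using R by simp
    then obtain r where r: "r \<in> S" "r < R + inverse (real (Suc k))"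
      using cInf_lessD[OF ne] by blast
    have "measure M {\<omega> \<in> space M. \<bar>\<kappa> \<omega> - m\<bar> > R + inverse (real (Suc k))}
      \<le> measure M {\<omega> \<in> space M. \<bar>\<kappa> \<omega> - m\<bar> > r}"
      by (rule finite_measure_mono) (use r in auto)
    with r show ?thesis by (auto simp: S_def)
  qed
  have "(\<lambda>k. measure M {\<omega> \<in> space M. \<bar>\<kappa> \<omega> - m\<bar> > R + inverse (real (Suc k))})
    \<longlonglongrightarrow> measure M (\<Union>k. {\<omega> \<in> space M. \<bar>\<kappa> \<omega> - m\<bar> > R + inverse (real (Suc k))})"
  proof (rule finite_Lim_measure_incseq)
    show "incseq (\<lambda>k. {\<omega> \<in> space M. \<bar>\<kappa> \<omega> - m\<bar> > R + inverse (real (Suc k))})"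
    proof (rule incseq_SucI, safe)
      fix k \<omega> assume "R + inverse (real (Suc k)) < \<bar>\<kappa> \<omega> - m\<bar>"
      moreover have "inverse (real (Suc (Suc k))) \<le> inverse (real (Suc k))" by simp
      ultimately show "R + inverse (real (Suc (Suc k))) < \<bar>\<kappa> \<omega> - m\<bar>" by linarith
    qed
  qed auto
  also have "(\<Union>k. {\<omega> \<in> space M. \<bar>\<kappa> \<omega> - m\<bar> > R + inverse (real (Suc k))}) = {\<omega> \<in> space M. \<bar>\<kappa> \<omega> - m\<bar> > R}"
  proof safe
    fix k \<omega> assume "R + inverse (real (Suc k)) < \<bar>\<kappa> \<omega> - m\<bar>"
    moreover have "inverse (real (Suc k)) > 0" by simp
    ultimately show "R < \<bar>\<kappa> \<omega> - m\<bar>" by linarith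
  next
    fix \<omega> assume \<omega>: "\<omega> \<in> space M" "R < \<bar>\<kappa> \<omega> - m\<bar>"
    then obtain k where "inverse (real (Suc k)) < \<bar>\<kappa> \<omega> - m\<bar> - R"
      using reals_Archimedean[of "\<bar>\<kappa> \<omega> - m\<bar> - R"] by auto
    then show "\<omega> \<in> (\<Union>k. {\<omega> \<in> space M. \<bar>\<kappa> \<omega> - m\<bar> > R + inverse (real (Suc k))})"
      using \<omega> by (auto simp: algebra_simps)
  qed
  finally have "measure M {\<omega> \<in> space M. \<bar>\<kappa> \<omega> - m\<bar> > R} \<le> \<delta>"
    by (rule LIMSEQ_le_const2) (use step in auto)
  then show "measure M {\<omega> \<in> space M. \<bar>\<kappa> \<omega> - m\<bar> > err_quantile M \<kappa> m \<delta>} \<le> \<delta>"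
    by (simp add: R_def)
qed

section \<open>Deterministic perturbation bounds\<close>

text \<open>Only altered coordinates survive in the difference. This serves both the deficits, which
  oscillate by at most 1, and the weighted summands, which oscillate by at most 2 K / a.\<close>

lemma contaminated_sum_diff:
  fixes f :: "real \<Rightarrow> real"
  assumes y: "y \<in> contaminated n \<epsilon> x" and f: "\<And>u v. \<bar>f u - f v\<bar> \<le> B"
  shows "\<bar>(\<Sum>i<n. f (x i)) - (\<Sum>i<n. f (y i))\<bar> \<le> B * (real n * \<epsilon>)"
proof -
  let ?D = "{i. i < n \<and> x i \<noteq> y i}"
  have B: "0 \<le> B" using f[of 0 0] by simp
  have "(\<Sum>i<n. f (x i)) - (\<Sum>i<n. f (y i)) = (\<Sum>i<n. f (x i) - f (y i))"
    by (simp add: sum_subtractf)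
  also have "\<dots> = (\<Sum>i\<in>?D. f (x i) - f (y i))"
    by (rule sum.mono_neutral_right) auto
  finally have "\<bar>(\<Sum>i<n. f (x i)) - (\<Sum>i<n. f (y i))\<bar> \<le> (\<Sum>i\<in>?D. \<bar>f (x i) - f (y i)\<bar>)"
    using sum_abs by metis
  also have "\<dots> \<le> real (card ?D) * B"
    by (rule sum_bounded_above) (rule f)
  also have "\<dots> \<le> real n * \<epsilon> * B"
    using y B by (intro mult_right_mono) (auto simp: contaminated_def)
  finally show ?thesis by (simp add: mult_ac)
qed

section \<open>Weights at an extended-real scale and the estimator under contamination\<close>

locale shrinkage_weight =
  fixes w :: "real \<Rightarrow> real" and K :: real
  assumes weight: "weight_fun w"
    and K_ge_1: "1 \<le> K"
    and mult_w_le: "\<And>t. 0 \<le> t \<Longrightarrow> t * w t \<le> K"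
begin

lemma w_nonneg: "0 \<le> t \<Longrightarrow> 0 \<le> w t"
  and w_le_1: "0 \<le> t \<Longrightarrow> w t \<le> 1"
  and w_antimono: "0 \<le> s \<Longrightarrow> s \<le> t \<Longrightarrow> w t \<le> w s"
  and w_0: "w 0 = 1"
  using weight by (auto simp: weight_fun_def)

lemma abs_mult_w_le:
  assumes "0 < a"
  shows "\<bar>u\<bar> * w (a * \<bar>u\<bar>) \<le> K / a"
  using mult_w_le[of "a * \<bar>u\<bar>"] assms by (simp add: field_simps)

context
  fixes a\<^sub>0 :: real and a :: ereal
  assumes a0: "0 < a\<^sub>0" and le: "ereal a\<^sub>0 \<le> a"
begin

lemma weight_ext_nonneg: "0 \<le> weight_ext w (a * ereal \<bar>u\<bar>)"
  and weight_ext_le_w: "weight_ext w (a * ereal \<bar>u\<bar>) \<le> w (a\<^sub>0 * \<bar>u\<bar>)"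
proof -
  have "0 \<le> weight_ext w (a * ereal \<bar>u\<bar>) \<and> weight_ext w (a * ereal \<bar>u\<bar>) \<le> w (a\<^sub>0 * \<bar>u\<bar>)"
  proof (cases a)
    case (real r)
    then have "0 < r" "a\<^sub>0 * \<bar>u\<bar> \<le> r * \<bar>u\<bar>"
      using a0 le by (auto intro!: mult_right_mono)
    then show ?thesis
      using real a0 by (auto simp: weight_ext_def intro!: w_nonneg w_antimono)
  next
    \<comment> \<open>Since \<open>\<infinity> * 0 = 0\<close>, an observation equal to the centre
      keeps weight 1 even at infinite scale; all others get weight 0.\<close>
    case PInf
    then show ?thesis
      using a0 by (cases "u = 0") (auto simp: weight_ext_def w_0 intro!: w_nonneg)
  next
    case MInf
    then show ?thesis using le by auto
  qed
  then show "0 \<le> weight_ext w (a * ereal \<bar>u\<bar>)" "weight_ext w (a * ereal \<bar>u\<bar>) \<le> w (a\<^sub>0 * \<bar>u\<bar>)"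
    by auto
qed

lemma w_le_weight_ext:
  assumes "a \<le> ereal b"
  shows "w (b * \<bar>u\<bar>) \<le> weight_ext w (a * ereal \<bar>u\<bar>)"
proof -
  obtain r where r: "a = ereal r" using assms le by (cases a) auto
  then have "0 \<le> r * \<bar>u\<bar>" "r * \<bar>u\<bar> \<le> b * \<bar>u\<bar>"
    using a0 le assms by (auto intro!: mult_right_mono)
  then show ?thesis
    using r by (auto simp: weight_ext_def intro!: w_antimono)
qed

lemma abs_mult_weight_ext_le: "\<bar>u * weight_ext w (a * ereal \<bar>u\<bar>)\<bar> \<le> K / a\<^sub>0"
proof -
  have "\<bar>u * weight_ext w (a * ereal \<bar>u\<bar>)\<bar> = \<bar>u\<bar> * weight_ext w (a * ereal \<bar>u\<bar>)"
    using weight_ext_nonneg[of u] by (simp add: abs_mult)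
  also have "\<dots> \<le> \<bar>u\<bar> * w (a\<^sub>0 * \<bar>u\<bar>)"
    by (intro mult_left_mono weight_ext_le_w) auto
  finally show ?thesis using abs_mult_w_le[OF a0, of u] by linarith
qed

text \<open>The price of replacing the random scale by the fixed one. With z the weight at
  \<open>a\<^sub>0\<close> and v the weight at \<open>a\<close>, z - v \<le> z (1 - v) because z
  \<le> 1; then \<bar>u\<bar> z \<le> K / \<open>a\<^sub>0\<close> removes the unbounded factor, and
  1 - v is at most the deficit at the upper level.\<close>

lemma weight_ext_perturbation:
  assumes "a \<le> ereal b"
  shows "\<bar>u * w (a\<^sub>0 * \<bar>u\<bar>) - u * weight_ext w (a * ereal \<bar>u\<bar>)\<bar> \<le> K / a\<^sub>0 * (1 - w (b * \<bar>u\<bar>))"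
proof -
  define v where "v = weight_ext w (a * ereal \<bar>u\<bar>)"
  define z where "z = w (a\<^sub>0 * \<bar>u\<bar>)"
  have v: "0 \<le> v" "v \<le> z" "w (b * \<bar>u\<bar>) \<le> v"
    using weight_ext_nonneg[of u] weight_ext_le_w[of u] w_le_weight_ext[OF assms, of u]
    by (auto simp: v_def z_def)
  have z: "z \<le> 1" using a0 by (auto simp: z_def intro!: w_le_1)
  have "\<bar>u * z - u * v\<bar> = \<bar>u\<bar> * (z - v)"
    using v by (simp add: right_diff_distrib[symmetric] abs_mult)
  also have "\<dots> \<le> \<bar>u\<bar> * (z * (1 - v))"
    using v z mult_right_mono[of z 1 v] by (intro mult_left_mono) (auto simp: algebra_simps)
  also have "\<dots> = \<bar>u\<bar> * z * (1 - v)" by simp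
  also have "\<dots> \<le> K / a\<^sub>0 * (1 - w (b * \<bar>u\<bar>))"
    using abs_mult_w_le[OF a0, of u] v z K_ge_1 a0
    by (intro mult_mono) (auto simp: z_def[symmetric])
  finally show ?thesis by (simp add: v_def z_def)
qed

end

lemma deficit_sum_contaminated:
  assumes "y \<in> contaminated n \<epsilon> x" "0 < a"
  shows "\<bar>(\<Sum>i<n. 1 - w (a * \<bar>x i - \<kappa>\<bar>)) - (\<Sum>i<n. 1 - w (a * \<bar>y i - \<kappa>\<bar>))\<bar> \<le> real n * \<epsilon>"
proof -
  have b: "0 \<le> w (a * \<bar>u - \<kappa>\<bar>)" "w (a * \<bar>u - \<kappa>\<bar>) \<le> 1" for u
    using assms(2) by (auto intro!: w_nonneg w_le_1)
  have "\<bar>(1 - w (a * \<bar>u - \<kappa>\<bar>)) - (1 - w (a * \<bar>v - \<kappa>\<bar>))\<bar> \<le> 1" for u v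
    using b[of u] b[of v] by linarith
  from contaminated_sum_diff[OF assms(1), of "\<lambda>u. 1 - w (a * \<bar>u - \<kappa>\<bar>)" 1, OF this] show ?thesis by simp
qed

text \<open>Deficits grow with the scale. An admissible scale below \<open>a\<^sub>0\<close> would
  force the contaminated deficit sum at \<open>a\<^sub>0\<close> up to \<eta>, which the strict
  inequality forbids.\<close>

lemma alpha_hat_ge:
  assumes y: "y \<in> contaminated n \<epsilon> x" and a0: "0 < a\<^sub>0"
    and sum: "(\<Sum>i<n. 1 - w (a\<^sub>0 * \<bar>x i - \<kappa>\<bar>)) + \<epsilon> * real n < \<eta>"
  shows "ereal a\<^sub>0 \<le> alpha_hat w \<eta> n \<kappa> y"
  unfolding alpha_hat_def
proof (rule Inf_greatest, safe)
  fix a assume a: "0 < a" "(\<Sum>i<n. w (a * \<bar>y i - \<kappa>\<bar>)) \<le> real n - \<eta>"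
  show "ereal a\<^sub>0 \<le> ereal a"
  proof (rule ccontr)
    assume "\<not> ereal a\<^sub>0 \<le> ereal a"
    then have "(\<Sum>i<n. w (a\<^sub>0 * \<bar>y i - \<kappa>\<bar>)) \<le> (\<Sum>i<n. w (a * \<bar>y i - \<kappa>\<bar>))"
      using a by (intro sum_mono w_antimono mult_right_mono) auto
    with a deficit_sum_contaminated[OF y a0, of \<kappa>] sum show False
      by (simp add: sum_subtractf algebra_simps)
  qed
qed

lemma alpha_hat_le:
  assumes y: "y \<in> contaminated n \<epsilon> x" and b: "0 < b"
    and sum: "\<eta> + \<epsilon> * real n \<le> (\<Sum>i<n. 1 - w (b * \<bar>x i - \<kappa>\<bar>))"
  shows "alpha_hat w \<eta> n \<kappa> y \<le> ereal b"
  unfolding alpha_hat_def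
  using b deficit_sum_contaminated[OF y b, of \<kappa>] sum
  by (intro Inf_lower) (auto simp: sum_subtractf algebra_simps)

lemma mu_hat_diff_base_le:
  assumes n: "1 \<le> n" and a0: "0 < a\<^sub>0" and le: "ereal a\<^sub>0 \<le> alpha_hat w \<eta> n \<kappa> y"
  shows "\<bar>mu_hat w \<eta> n \<kappa> y - \<kappa>\<bar> \<le> K / a\<^sub>0"
proof -
  let ?f = "\<lambda>i. (y i - \<kappa>) * weight_ext w (alpha_hat w \<eta> n \<kappa> y * ereal \<bar>y i - \<kappa>\<bar>)"
  have "\<bar>\<Sum>i<n. ?f i\<bar> \<le> (\<Sum>i<n. \<bar>?f i\<bar>)" by (rule sum_abs)
  also have "\<dots> \<le> real (card {..<n}) * (K / a\<^sub>0)"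
    by (rule sum_bounded_above) (rule abs_mult_weight_ext_le[OF a0 le])
  finally show ?thesis
    using n by (simp add: mu_hat_def field_simps)
qed

text \<open>Three replacements in this order: the corrupted sample by the clean one while the scale
  stays \<open>alpha_hat\<close> of the corrupted sample, then this scale by
  \<open>a\<^sub>0\<close>, then the resulting i.i.d. sum by its target. They cost 2 \<epsilon> K /
  \<open>a\<^sub>0\<close>, s K / \<open>a\<^sub>0\<close> and d.\<close>

lemma mu_hat_error_le:
  assumes n: "1 \<le> n" and y: "y \<in> contaminated n \<epsilon> x" and a0: "0 < a\<^sub>0"
    and le: "ereal a\<^sub>0 \<le> alpha_hat w \<eta> n \<kappa> y" and le': "alpha_hat w \<eta> n \<kappa> y \<le> ereal b"
    and dev: "\<bar>\<Sum>i<n. (x i - \<kappa>) * w (a\<^sub>0 * \<bar>x i - \<kappa>\<bar>) - (m - \<kappa>)\<bar> \<le> real n * d"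
    and sum: "(\<Sum>i<n. 1 - w (b * \<bar>x i - \<kappa>\<bar>)) \<le> real n * s"
  shows "\<bar>mu_hat w \<eta> n \<kappa> y - m\<bar> \<le> d + K / a\<^sub>0 * (2 * \<epsilon> + s)"
proof -
  define f where "f = (\<lambda>u. (u - \<kappa>) * weight_ext w (alpha_hat w \<eta> n \<kappa> y * ereal \<bar>u - \<kappa>\<bar>))"
  define T where "T = (\<lambda>u. (u - \<kappa>) * w (a\<^sub>0 * \<bar>u - \<kappa>\<bar>))"
  have f: "\<bar>f u\<bar> \<le> K / a\<^sub>0" for u
    unfolding f_def by (rule abs_mult_weight_ext_le[OF a0 le])
  have "\<bar>f u - f v\<bar> \<le> 2 * (K / a\<^sub>0)" for u v
    using f[of u] f[of v] by linarith
  then have 1: "\<bar>(\<Sum>i<n. f (x i)) - (\<Sum>i<n. f (y i))\<bar> \<le> 2 * (K / a\<^sub>0) * (real n * \<epsilon>)"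
    by (rule contaminated_sum_diff[OF y])
  have "\<bar>(\<Sum>i<n. T (x i)) - (\<Sum>i<n. f (x i))\<bar> \<le> (\<Sum>i<n. \<bar>T (x i) - f (x i)\<bar>)"
    unfolding sum_subtractf[symmetric] by (rule sum_abs)
  also have "\<dots> \<le> (\<Sum>i<n. K / a\<^sub>0 * (1 - w (b * \<bar>x i - \<kappa>\<bar>)))"
    unfolding f_def T_def by (intro sum_mono weight_ext_perturbation[OF a0 le le'])
  also have "\<dots> \<le> K / a\<^sub>0 * (real n * s)"
    unfolding sum_distrib_left[symmetric] using K_ge_1 a0 sum by (intro mult_left_mono) auto
  finally have 2: "\<bar>(\<Sum>i<n. T (x i)) - (\<Sum>i<n. f (x i))\<bar> \<le> K / a\<^sub>0 * (real n * s)" .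
  have 3: "\<bar>(\<Sum>i<n. T (x i)) - real n * (m - \<kappa>)\<bar> \<le> real n * d"
    using dev by (simp add: T_def sum_subtractf)
  have "real n * (mu_hat w \<eta> n \<kappa> y - m) = (\<Sum>i<n. f (y i)) - real n * (m - \<kappa>)"
    using n by (simp add: mu_hat_def f_def field_simps)
  then have "real n * \<bar>mu_hat w \<eta> n \<kappa> y - m\<bar> = \<bar>(\<Sum>i<n. f (y i)) - real n * (m - \<kappa>)\<bar>"
    by (metis abs_mult abs_of_nat)
  also have "\<dots> \<le> real n * d + 2 * (K / a\<^sub>0) * (real n * \<epsilon>) + K / a\<^sub>0 * (real n * s)"
    using 1 2 3 by linarith
  also have "\<dots> = real n * (d + K / a\<^sub>0 * (2 * \<epsilon> + s))"
    by (simp add: algebra_simps)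
  finally show ?thesis
    using n by simp
qed

end

section \<open>Concentration and level functions\<close>

text \<open>Chernoff's bound at rate 1 / B with B the maximum in the threshold: B \<ge> b keeps h /
  B in [-1, 1], where the quadratic bound on exp holds, and B^2 \<ge> n V / L makes the
  second-moment contribution at most L. Of the 3 L in the threshold, 2 L remain. \<beta> absorbs a
  non-zero mean and V bounds the raw second moment, so \<open>h\<close> need not be centred.\<close>

lemma bernstein_one_sided:
  fixes h :: "'b \<Rightarrow> real"
  assumes "prob_space P" and h[measurable]: "h \<in> borel_measurable P"
    and b: "0 < b" and hb: "\<And>x. x \<in> space P \<Longrightarrow> \<bar>h x\<bar> \<le> b"
    and mean: "(\<integral>x. h x \<partial>P) \<le> \<beta>" and var: "(\<integral>x. (h x)\<^sup>2 \<partial>P) \<le> V" and L: "0 < L"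
  shows "measure (PiM {..<n} (\<lambda>_. P)) {x \<in> space (PiM {..<n} (\<lambda>_. P)).
      real n * \<beta> + 3 * L * max b (sqrt (real n * V / L)) \<le> (\<Sum>i<n. h (x i))} \<le> exp (- 2 * L)"
proof -
  interpret P: prob_space P by fact
  define B where "B = max b (sqrt (real n * V / L))"
  have B: "0 < B" "b \<le> B" using b by (auto simp: B_def)
  have V0: "0 \<le> V" using var by (rule order_trans[rotated]) (auto intro: integral_nonneg_AE)
  have nV: "real n * V \<le> L * B\<^sup>2"
  proof -
    have "(sqrt (real n * V / L))\<^sup>2 \<le> B\<^sup>2"
      using L V0 by (intro power_mono) (auto simp: B_def)
    then show ?thesis using L V0 by (simp add: field_simps)
  qed
  have hB: "\<bar>h x / B\<bar> \<le> 1" if "x \<in> space P" for x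
    using hb[OF that] B by (simp add: field_simps)
  have i1: "integrable P h"
    by (rule P.integrable_const_bound[where B = b]) (use hb in auto)
  have i2: "integrable P (\<lambda>x. (h x)\<^sup>2)"
    by (rule P.integrable_const_bound[where B = "b\<^sup>2"])
      (use hb b in \<open>auto simp: abs_le_square_iff[symmetric]\<close>)
  have "(\<integral>x. exp (h x / B) \<partial>P) \<le> (\<integral>x. 1 + h x / B + (h x)\<^sup>2 / B\<^sup>2 \<partial>P)"
  proof (rule integral_mono)
    show "integrable P (\<lambda>x. exp (h x / B))"
      by (rule P.integrable_const_bound[where B = "exp 1"])
        (use hB in \<open>auto intro!: AE_I2 intro: order.trans[OF abs_ge_self]\<close>)
    show "integrable P (\<lambda>x. 1 + h x / B + (h x)\<^sup>2 / B\<^sup>2)"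
      using i1 i2 by auto
    show "exp (h x / B) \<le> 1 + h x / B + (h x)\<^sup>2 / B\<^sup>2" if "x \<in> space P" for x
      using exp_le_one_plus_square[OF hB[OF that]] by (simp add: power_divide)
  qed
  also have "\<dots> = 1 + (\<integral>x. h x \<partial>P) / B + (\<integral>x. (h x)\<^sup>2 \<partial>P) / B\<^sup>2"
    using i1 i2 by (simp add: P.prob_space)
  also have "\<dots> \<le> 1 + (\<beta> / B + V / B\<^sup>2)"
    using mean var B divide_right_mono[of _ \<beta> B] divide_right_mono[of _ V "B\<^sup>2"] by fastforce
  also have "\<dots> \<le> exp (\<beta> / B + V / B\<^sup>2)" by (rule exp_ge_add_one_self)
  finally have mgf: "(\<integral>x. exp (h x / B) \<partial>P) \<le> exp (\<beta> / B + V / B\<^sup>2)" .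
  have "{x \<in> space (PiM {..<n} (\<lambda>_. P)). real n * \<beta> + 3 * L * B \<le> (\<Sum>i<n. h (x i))}
    = {x \<in> space (PiM {..<n} (\<lambda>_. P)). real n * \<beta> / B + 3 * L \<le> (\<Sum>i<n. h (x i) / B)}"
  proof -
    have "real n * \<beta> + 3 * L * B \<le> S \<longleftrightarrow> real n * \<beta> / B + 3 * L \<le> S / B" for S
      using divide_le_cancel[of "real n * \<beta> + 3 * L * B" B S] B by (simp add: add_divide_distrib)
    then show ?thesis unfolding sum_divide_distrib[symmetric] by simp
  qed
  also have "measure (PiM {..<n} (\<lambda>_. P)) \<dots>
    \<le> exp (real n * (\<beta> / B + V / B\<^sup>2) - (real n * \<beta> / B + 3 * L))"
    by (rule chernoff_PiM[OF assms(1) _ hB mgf]) auto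
  also have "\<dots> \<le> exp (- 2 * L)"
  proof -
    have "real n * V / B\<^sup>2 \<le> L" using nV B by (simp add: field_simps)
    then show ?thesis by (simp add: algebra_simps)
  qed
  finally show ?thesis by (simp add: B_def)
qed

lemma bernstein_two_sided:
  fixes h :: "'b \<Rightarrow> real"
  assumes "prob_space P" and h[measurable]: "h \<in> borel_measurable P"
    and b: "0 < b" and hb: "\<And>x. x \<in> space P \<Longrightarrow> \<bar>h x\<bar> \<le> b"
    and mean: "\<bar>\<integral>x. h x \<partial>P\<bar> \<le> \<beta>" and var: "(\<integral>x. (h x)\<^sup>2 \<partial>P) \<le> V" and L: "0 < L"
  shows "measure (PiM {..<n} (\<lambda>_. P)) {x \<in> space (PiM {..<n} (\<lambda>_. P)).
      real n * \<beta> + 3 * L * max b (sqrt (real n * V / L)) \<le> \<bar>\<Sum>i<n. h (x i)\<bar>} \<le> 2 * exp (- 2 * L)"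
proof -
  interpret P: prob_space P by fact
  let ?Q = "PiM {..<n} (\<lambda>_. P)"
  interpret Q: prob_space ?Q by (rule prob_space_PiM) (rule assms(1))
  define u where "u = real n * \<beta> + 3 * L * max b (sqrt (real n * V / L))"
  have "{x \<in> space ?Q. u \<le> \<bar>\<Sum>i<n. h (x i)\<bar>}
    = {x \<in> space ?Q. u \<le> (\<Sum>i<n. h (x i))} \<union> {x \<in> space ?Q. u \<le> (\<Sum>i<n. - h (x i))}"
    unfolding sum_negf by (auto simp: abs_if)
  also have "measure ?Q \<dots> \<le> measure ?Q {x \<in> space ?Q. u \<le> (\<Sum>i<n. h (x i))}
     + measure ?Q {x \<in> space ?Q. u \<le> (\<Sum>i<n. - h (x i))}"
    by (rule measure_Un_le) measurable
  also have "\<dots> \<le> exp (- 2 * L) + exp (- 2 * L)"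
  proof (rule add_mono)
    have m: "(\<integral>x. h x \<partial>P) \<le> \<beta>" "(\<integral>x. - h x \<partial>P) \<le> \<beta>"
      using mean by auto
    show "measure ?Q {x \<in> space ?Q. u \<le> (\<Sum>i<n. h (x i))} \<le> exp (- 2 * L)"
      unfolding u_def by (rule bernstein_one_sided[OF assms(1) h b hb m(1) var L])
    show "measure ?Q {x \<in> space ?Q. u \<le> (\<Sum>i<n. - h (x i))} \<le> exp (- 2 * L)"
      unfolding u_def by (rule bernstein_one_sided[OF assms(1) _ b _ m(2) _ L]) (use hb var in auto)
  qed
  finally show ?thesis by (simp add: u_def)
qed

section \<open>The mean deficit of an atom-free law and its level function\<close>

locale shrinkage = shrinkage_weight w K + prob_space P
  for w :: "real \<Rightarrow> real" and K :: real and P :: "real measure" +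
  assumes sets_P[measurable_cong]: "sets P = sets borel"
    and no_atom: "\<And>x. measure P {x} = 0"
begin

lemma space_P[simp]: "space P = UNIV"
  using sets_eq_imp_space_eq[OF sets_P] by simp

lemma prob_UNIV[simp]: "prob UNIV = 1"
  using prob_space by simp

text \<open>\<open>weight_fun\<close> says nothing about \<open>w\<close> on the negative reals, so \<open>w\<close> itself need not be measurable.\<close>

definition W :: "real \<Rightarrow> real" where
  "W t = w (max 0 t)"

lemma W_eq: "0 \<le> t \<Longrightarrow> W t = w t"
  by (simp add: W_def)

lemma antimono_W: "antimono W"
  by (auto simp: antimono_def W_def intro!: w_antimono)

lemma measurable_W[measurable]: "W \<in> borel_measurable borel"
  by (rule borel_measurable_antimono[OF antimono_W])

lemma measurable_w_abs[measurable (raw)]: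
  assumes "0 \<le> a" and [measurable]: "h \<in> borel_measurable N"
  shows "(\<lambda>z. w (a * \<bar>h z\<bar>)) \<in> borel_measurable N"
proof -
  have "(\<lambda>z. w (a * \<bar>h z\<bar>)) = (\<lambda>z. W (a * \<bar>h z\<bar>))"
    using assms(1) by (simp add: W_eq)
  then show ?thesis by simp
qed

text \<open>At scale 0 every observation is sent to 0, so no null set can excuse a jump there.
  Right-continuity of \<open>w\<close> settles one side, and \<open>W\<close> is constant on the
  other.\<close>

lemma isCont_W_0: "isCont W 0"
proof -
  have "continuous (at_right 0) w" using weight by (auto simp: weight_fun_def)
  then have "(w \<longlongrightarrow> W 0) (at_right 0)" by (simp add: continuous_within W_def)
  then have r: "(W \<longlongrightarrow> W 0) (at_right 0)"
    by (rule Lim_transform_eventually) (auto simp: eventually_at_filter W_eq)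
  have "((\<lambda>_. W 0) \<longlongrightarrow> W 0) (at_left 0)" by simp
  then have l: "(W \<longlongrightarrow> W 0) (at_left 0)"
    by (rule Lim_transform_eventually) (auto simp: eventually_at_filter W_def)
  from l r show ?thesis by (simp add: isCont_def filterlim_at_split)
qed

lemma AE_not_countable:
  assumes "countable A"
  shows "AE x in P. x \<notin> A"
proof (rule AE_I')
  have "{x} \<in> null_sets P" for x
    using no_atom[of x] by (auto simp: null_sets_def emeasure_eq_measure)
  then have "(\<Union>x\<in>A. {x}) \<in> null_sets P"
    using assms by (intro null_sets_UN') auto
  then show "A \<in> null_sets P" by simp
qed auto

definition G :: "real \<Rightarrow> real \<Rightarrow> real" where
  "G \<kappa> a = (\<integral>x. 1 - w (a * \<bar>x - \<kappa>\<bar>) \<partial>P)"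

lemma deficit_bounds:
  assumes "0 \<le> a"
  shows "0 \<le> 1 - w (a * \<bar>u\<bar>)" "1 - w (a * \<bar>u\<bar>) \<le> 1"
  using w_nonneg[of "a * \<bar>u\<bar>"] w_le_1[of "a * \<bar>u\<bar>"] assms by auto

lemma integrable_deficit:
  assumes "0 \<le> a"
  shows "integrable P (\<lambda>x. 1 - w (a * \<bar>x - \<kappa>\<bar>))"
  by (rule integrable_const_bound[where B = 1]) (use deficit_bounds assms in auto)

lemma G_mono: "0 \<le> a \<Longrightarrow> a \<le> b \<Longrightarrow> G \<kappa> a \<le> G \<kappa> b"
  unfolding G_def by (intro integral_mono integrable_deficit diff_left_mono w_antimono mult_right_mono) auto

lemma G_0: "G \<kappa> 0 = 0"
  by (simp add: G_def w_0)

lemma G_tendsto: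
  assumes "\<And>k. 0 \<le> a k"
    and "AE x in P. (\<lambda>k. w (a k * \<bar>x - \<kappa>\<bar>)) \<longlonglongrightarrow> g x" and [measurable]: "g \<in> borel_measurable P"
  shows "(\<lambda>k. G \<kappa> (a k)) \<longlonglongrightarrow> (\<integral>x. 1 - g x \<partial>P)"
  unfolding G_def
proof (rule integral_dominated_convergence[where w = "\<lambda>_. 1"])
  show "AE x in P. (\<lambda>k. 1 - w (a k * \<bar>x - \<kappa>\<bar>)) \<longlonglongrightarrow> 1 - g x"
    using assms(2) by eventually_elim (intro tendsto_intros)
  show "AE x in P. norm (1 - w (a k * \<bar>x - \<kappa>\<bar>)) \<le> 1" for k
    using deficit_bounds[OF assms(1)] by auto
qed (use assms in auto)

text \<open>For a > 0 each jump of \<open>W\<close> has at most two preimages under x \<mapsto> a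
  \<bar>x - \<kappa>\<bar>, so the exceptional set is countable and hence null.\<close>

lemma AE_isCont_W:
  assumes "0 \<le> a"
  shows "AE x in P. isCont W (a * \<bar>x - \<kappa>\<bar>)"
proof (cases "a = 0")
  case True
  then show ?thesis using isCont_W_0 by simp
next
  case False
  define D where "D = {t. \<not> isCont W t}"
  have "countable D" unfolding D_def by (rule countable_discontinuities_antimono[OF antimono_W])
  then have "countable ((\<lambda>t. \<kappa> + t / a) ` D \<union> (\<lambda>t. \<kappa> - t / a) ` D)" by auto
  then have "AE x in P. x \<notin> (\<lambda>t. \<kappa> + t / a) ` D \<union> (\<lambda>t. \<kappa> - t / a) ` D"
    by (rule AE_not_countable)
  then show ?thesis
  proof eventually_elim
    case (elim x)
    show ?case
    proof (rule ccontr)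
      assume "\<not> isCont W (a * \<bar>x - \<kappa>\<bar>)"
      then have "a * \<bar>x - \<kappa>\<bar> \<in> D" by (simp add: D_def)
      moreover have "x = \<kappa> + a * \<bar>x - \<kappa>\<bar> / a \<or> x = \<kappa> - a * \<bar>x - \<kappa>\<bar> / a"
        using False by auto
      ultimately show False using elim by blast
    qed
  qed
qed

lemma continuous_on_G: "continuous_on {0..} (G \<kappa>)"
proof (rule continuous_on_sequentiallyI)
  fix a :: "nat \<Rightarrow> real" and b assume a: "\<forall>k. a k \<in> {0..}" and b: "b \<in> {0..}" and lim: "a \<longlonglongrightarrow> b"
  have "AE x in P. (\<lambda>k. w (a k * \<bar>x - \<kappa>\<bar>)) \<longlonglongrightarrow> w (b * \<bar>x - \<kappa>\<bar>)"
    using AE_isCont_W[of b \<kappa>, OF b[unfolded atLeast_iff]]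
  proof eventually_elim
    case (elim x)
    then have "isCont W (b * \<bar>x - \<kappa>\<bar>)" by simp
    moreover have "(\<lambda>k. a k * \<bar>x - \<kappa>\<bar>) \<longlonglongrightarrow> b * \<bar>x - \<kappa>\<bar>"
      by (intro tendsto_intros lim)
    ultimately have "(\<lambda>k. W (a k * \<bar>x - \<kappa>\<bar>)) \<longlonglongrightarrow> W (b * \<bar>x - \<kappa>\<bar>)"
      by (rule isCont_tendsto_compose)
    then show ?case using a b by (simp add: W_eq)
  qed
  then show "(\<lambda>k. G \<kappa> (a k)) \<longlonglongrightarrow> G \<kappa> b"
    unfolding G_def[of \<kappa> b] by (intro G_tendsto) (use a b in auto)
qed

lemma G_tendsto_1: "(\<lambda>k. G \<kappa> (real k)) \<longlonglongrightarrow> 1"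
proof -
  have "AE x in P. x \<notin> {\<kappa>}" by (rule AE_not_countable) simp
  then have "AE x in P. (\<lambda>k. w (real k * \<bar>x - \<kappa>\<bar>)) \<longlonglongrightarrow> 0"
  proof eventually_elim
    case (elim x)
    have "filterlim (\<lambda>k. \<bar>x - \<kappa>\<bar> * real k) at_top sequentially"
      using elim by (intro filterlim_tendsto_pos_mult_at_top[OF tendsto_const] filterlim_real_sequentially) auto
    moreover have "(w \<longlongrightarrow> 0) at_top" using weight by (auto simp: weight_fun_def)
    ultimately show ?case
      using filterlim_compose by (fastforce simp: mult.commute)
  qed
  then have "(\<lambda>k. G \<kappa> (real k)) \<longlonglongrightarrow> (\<integral>x. 1 - 0 \<partial>P)"
    by (intro G_tendsto) auto
  then show ?thesis by (simp add: prob_space)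
qed

text \<open>A quantile-type inverse of \<open>G \<kappa>\<close>. Taking the infimum, rather than
  choosing some preimage of \<open>g\<close>, makes the level measurable in \<kappa>: by
  monotonicity of \<open>G \<kappa>\<close>, the level is below \<open>a\<close> iff
  \<open>g \<le> G \<kappa> r\<close> for some positive rational \<open>r\<close> below
  \<open>a\<close>.\<close>

definition level :: "real \<Rightarrow> real \<Rightarrow> real" where
  "level g \<kappa> = Inf {a. 0 < a \<and> g \<le> G \<kappa> a}"

context
  fixes g :: real
  assumes g: "0 < g" "g < 1"
begin

lemma level_attained: "\<exists>a>0. G \<kappa> a = g"
proof -
  obtain k where k: "g < G \<kappa> (real k)"
    using order_tendstoD(1)[OF G_tendsto_1 g(2)] by (auto simp: eventually_sequentially)
  have "\<exists>a\<ge>0. a \<le> real k \<and> G \<kappa> a = g"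
    by (rule IVT') (use k g G_0 in \<open>auto intro: continuous_on_subset[OF continuous_on_G]\<close>)
  then show ?thesis using g G_0 by (metis less_eq_real_def)
qed

lemma bdd_below_level: "bdd_below {a. 0 < a \<and> g \<le> G \<kappa> a}"
  by (rule bdd_belowI[of _ 0]) auto

lemma level_le: "0 < a \<Longrightarrow> g \<le> G \<kappa> a \<Longrightarrow> level g \<kappa> \<le> a"
  unfolding level_def by (rule cInf_lower[OF _ bdd_below_level]) auto

lemma level_nonneg: "0 \<le> level g \<kappa>"
  unfolding level_def using level_attained[of \<kappa>] by (intro cInf_greatest) auto

lemma G_level: "G \<kappa> (level g \<kappa>) = g"
proof (rule antisym)
  obtain a where "0 < a" "G \<kappa> a = g" using level_attained by blast
  then show "G \<kappa> (level g \<kappa>) \<le> g"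
    using G_mono[OF level_nonneg level_le, of a \<kappa>] by auto
  \<comment> \<open>Since \<open>G \<kappa> 0 = 0 < g\<close>, admitting a = 0 adds no point. The
    right-hand form is visibly closed by continuity of \<open>G \<kappa>\<close>, so it contains its
    infimum.\<close>
  have eq: "{a. 0 < a \<and> g \<le> G \<kappa> a} = {a\<in>{0..}. g \<le> G \<kappa> a}"
    using g G_0[of \<kappa>] by (auto simp: less_le)
  have cl: "closed {a\<in>{0..}. g \<le> G \<kappa> a}"
    by (intro continuous_on_closed_Collect_le continuous_on_const continuous_on_G) auto
  have "level g \<kappa> \<in> {a\<in>{0..}. g \<le> G \<kappa> a}"
    unfolding level_def eq
  proof (rule closed_contains_Inf[OF _ _ cl])
    show "{a\<in>{0..}. g \<le> G \<kappa> a} \<noteq> {}"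
      using level_attained[of \<kappa>] unfolding eq[symmetric] by auto
    show "bdd_below {a\<in>{0..}. g \<le> G \<kappa> a}"
      using bdd_below_level[of \<kappa>] unfolding eq .
  qed
  then show "g \<le> G \<kappa> (level g \<kappa>)" by simp
qed

lemma level_pos: "0 < level g \<kappa>"
  using level_nonneg[of \<kappa>] G_level[of \<kappa>] G_0[of \<kappa>] g by (auto simp: less_le)

lemma measurable_level: "level g \<in> borel_measurable borel"
proof (rule borel_measurable_iff_less[THEN iffD2], rule allI)
  fix a
  have m: "(\<lambda>\<kappa>. G \<kappa> r) \<in> borel_measurable borel" if "0 \<le> r" for r
  proof -
    have "(\<lambda>\<kappa>. \<integral>x. 1 - w (r * \<bar>x - \<kappa>\<bar>) \<partial>P) \<in> borel_measurable borel"
      using that by (intro borel_measurable_lebesgue_integral) auto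
    then show ?thesis by (simp add: G_def[abs_def])
  qed
  have "{\<kappa> \<in> space borel. level g \<kappa> < a} = (\<Union>r\<in>{r\<in>\<rat>. 0 < r \<and> r < a}. {\<kappa> \<in> space borel. g \<le> G \<kappa> r})"
  proof safe
    fix \<kappa> assume "level g \<kappa> < a"
    then obtain r where "r \<in> \<rat>" "level g \<kappa> < r" "r < a" using Rats_dense_in_real by blast
    then show "\<kappa> \<in> (\<Union>r\<in>{r\<in>\<rat>. 0 < r \<and> r < a}. {\<kappa> \<in> space borel. g \<le> G \<kappa> r})"
      using level_pos[of \<kappa>] G_level[of \<kappa>] G_mono[of "level g \<kappa>" r \<kappa>] by auto
  next
    fix \<kappa> r assume "r < a" "0 < r" "g \<le> G \<kappa> r"
    then show "level g \<kappa> < a" using level_le[of r \<kappa>] by simp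
  qed
  also have "\<dots> \<in> sets borel"
    using countable_rat m by (intro sets.countable_UN'') (auto intro: countable_subset)
  finally show "{\<kappa> \<in> space borel. level g \<kappa> < a} \<in> sets borel" .
qed

end

text \<open>Deficits lie in [0, 1], so the chord bound gives a Bernoulli-type moment generating
  function that depends on the mean \<open>G \<kappa> a\<close> alone. The sign of \<open>c\<close>
  selects the upper or the lower tail.\<close>

lemma deficit_tail:
  assumes a: "0 \<le> a"
  shows "measure (PiM {..<n} (\<lambda>_. P)) {x \<in> space (PiM {..<n} (\<lambda>_. P)). u \<le> c * (\<Sum>i<n. 1 - w (a * \<bar>x i - \<kappa>\<bar>))}
    \<le> exp (real n * ((exp c - 1) * G \<kappa> a) - u)"
proof -
  let ?f = "\<lambda>x. 1 - w (a * \<bar>x - \<kappa>\<bar>)"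
  have f: "0 \<le> ?f x" "?f x \<le> 1" for x using deficit_bounds[OF a] by auto
  have [measurable]: "?f \<in> borel_measurable P" using a by simp
  have bound: "\<bar>c * ?f x\<bar> \<le> \<bar>c\<bar>" for x
    using f[of x] by (auto simp: abs_mult mult_left_le)
  have "(\<integral>x. exp (c * ?f x) \<partial>P) \<le> (\<integral>x. 1 + (exp c - 1) * ?f x \<partial>P)"
  proof (rule integral_mono)
    show "integrable P (\<lambda>x. exp (c * ?f x))"
      by (rule integrable_const_bound[where B = "exp \<bar>c\<bar>"])
        (use bound in \<open>auto intro!: AE_I2 intro: order.trans[OF abs_ge_self]\<close>)
    show "integrable P (\<lambda>x. 1 + (exp c - 1) * ?f x)"
      using integrable_deficit[OF a] by auto
    show "exp (c * ?f x) \<le> 1 + (exp c - 1) * ?f x" for x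
      by (rule exp_mult_le_chord[OF f])
  qed
  also have "\<dots> = 1 + (exp c - 1) * G \<kappa> a"
    using integrable_deficit[OF a, of \<kappa>] unfolding G_def
    by (subst Bochner_Integration.integral_add) (auto simp: prob_space simp del: Bochner_Integration.integral_diff)
  also have "\<dots> \<le> exp ((exp c - 1) * G \<kappa> a)" by (rule exp_ge_add_one_self)
  finally have "(\<integral>x. exp (c * ?f x) \<partial>P) \<le> exp ((exp c - 1) * G \<kappa> a)" .
  from chernoff_PiM[OF prob_space_axioms _ bound this, of n u]
  show ?thesis by (simp add: sum_distrib_left del: sum_subtractf)
qed

end

section \<open>The random sample\<close>

text \<open>The joint law of the base estimate and the sample agrees with the product law on
  rectangles, hence everywhere. A bound that holds for every fixed base estimate then integrates to
  the same bound. The sample is restricted to indices below \<open>n\<close> so that it lives in the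
  product space.\<close>

lemma indep_of_sample_measure_le:
  assumes "prob_space M" and iid: "iid_sample M P n X" and ind: "indep_of_sample M n \<kappa> X"
    and n: "1 \<le> n"
    and B: "B \<in> sets (borel \<Otimes>\<^sub>M PiM {..<n} (\<lambda>_. P))"
    and c: "\<And>k. measure (PiM {..<n} (\<lambda>_. P)) {x \<in> space (PiM {..<n} (\<lambda>_. P)). (k, x) \<in> B} \<le> c"
  shows "{\<omega> \<in> space M. (\<kappa> \<omega>, \<lambda>i\<in>{..<n}. X i \<omega>) \<in> B} \<in> sets M"
    and "measure M {\<omega> \<in> space M. (\<kappa> \<omega>, \<lambda>i\<in>{..<n}. X i \<omega>) \<in> B} \<le> c"
proof -
  interpret prob_space M by fact
  let ?N = "PiM {..<n} (\<lambda>_. borel :: real measure)"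
  let ?Q = "PiM {..<n} (\<lambda>_. P)"
  let ?X = "\<lambda>\<omega>. \<lambda>i\<in>{..<n}. X i \<omega>"
  have iv: "indep_vars (\<lambda>_. borel) X {..<n}" and dX: "\<And>i. i < n \<Longrightarrow> distr M borel (X i) = P"
    using iid by (auto simp: iid_sample_def)
  have rv: "X i \<in> borel_measurable M" if "i < n" for i
    using iv that by (auto simp: indep_vars_def2)
  have rX[measurable]: "?X \<in> measurable M ?N"
    using rv by (intro measurable_restrict) auto
  have k[measurable]: "\<kappa> \<in> borel_measurable M" using ind by (simp add: indep_of_sample_def)
  have distX: "distr M ?N ?X = ?Q"
  proof -
    \<comment> \<open>The characterisation of independence by the product law is applied to a
      non-empty index set, whence n \<ge> 1.\<close>
    have "distr M ?N ?X = PiM {..<n} (\<lambda>i. distr M borel (X i))"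
      using n by (intro indep_vars_iff_distr_eq_PiM'[THEN iffD1, OF _ _ iv] rv) (auto simp: lessThan_empty_iff)
    also have "\<dots> = ?Q" by (intro PiM_cong) (auto simp: dX)
    finally show ?thesis .
  qed
  have sP: "sets P = sets borel" using dX[of 0] n by (metis less_eq_Suc_le One_nat_def sets_distr)
  have sQ: "sets ?Q = sets ?N" by (intro sets_PiM_cong) (auto simp: sP)
  have B': "B \<in> sets (borel \<Otimes>\<^sub>M ?N)"
    using B sQ by (metis sets_pair_measure_cong)
  have pm[measurable]: "(\<lambda>\<omega>. (\<kappa> \<omega>, ?X \<omega>)) \<in> measurable M (borel \<Otimes>\<^sub>M ?N)" by measurable
  have eq: "{\<omega> \<in> space M. (\<kappa> \<omega>, ?X \<omega>) \<in> B} = (\<lambda>\<omega>. (\<kappa> \<omega>, ?X \<omega>)) -` B \<inter> space M" by auto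
  show "{\<omega> \<in> space M. (\<kappa> \<omega>, ?X \<omega>) \<in> B} \<in> sets M"
    unfolding eq by (rule measurable_sets[OF pm B'])
  interpret Q: prob_space ?Q
    unfolding distX[symmetric] by (rule prob_space_distr) (rule rX)
  interpret \<kappa>: prob_space "distr M borel \<kappa>" by (rule prob_space_distr) (rule k)
  have joint: "distr M borel \<kappa> \<Otimes>\<^sub>M ?Q = distr M (borel \<Otimes>\<^sub>M ?N) (\<lambda>\<omega>. (\<kappa> \<omega>, ?X \<omega>))"
  proof (rule pair_measure_eqI)
    show "sigma_finite_measure (distr M borel \<kappa>)" "sigma_finite_measure ?Q"
      by unfold_locales
    show "sets (distr M borel \<kappa> \<Otimes>\<^sub>M ?Q) = sets (distr M (borel \<Otimes>\<^sub>M ?N) (\<lambda>\<omega>. (\<kappa> \<omega>, ?X \<omega>)))"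
      using sQ by (metis sets_pair_measure_cong sets_distr)
    fix A C assume A: "A \<in> sets (distr M borel \<kappa>)" and C: "C \<in> sets ?Q"
    have C': "C \<in> sets ?N" using C sQ by simp
    have A': "A \<in> sets borel" using A by simp
    have "prob ((\<kappa> -` A \<inter> space M) \<inter> (?X -` C \<inter> space M)) = prob (\<kappa> -` A \<inter> space M) * prob (?X -` C \<inter> space M)"
      using ind A' C' unfolding indep_of_sample_def by (intro indep_setD) auto
    moreover have "(\<lambda>\<omega>. (\<kappa> \<omega>, ?X \<omega>)) -` (A \<times> C) \<inter> space M = (\<kappa> -` A \<inter> space M) \<inter> (?X -` C \<inter> space M)"
      by auto
    ultimately show "emeasure (distr M borel \<kappa>) A * emeasure ?Q C
      = emeasure (distr M (borel \<Otimes>\<^sub>M ?N) (\<lambda>\<omega>. (\<kappa> \<omega>, ?X \<omega>))) (A \<times> C)"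
      unfolding distX[symmetric]
      by (simp add: emeasure_distr[OF k A'] emeasure_distr[OF rX C'] emeasure_distr[OF pm pair_measureI[OF A' C']]
          emeasure_eq_measure ennreal_mult)
  qed
  have c0: "0 \<le> c" using c[of 0] measure_nonneg order_trans by blast
  have "emeasure M {\<omega> \<in> space M. (\<kappa> \<omega>, ?X \<omega>) \<in> B} = emeasure (distr M borel \<kappa> \<Otimes>\<^sub>M ?Q) B"
    unfolding joint eq by (rule emeasure_distr[symmetric, OF pm B'])
  also have "\<dots> = (\<integral>\<^sup>+k. emeasure ?Q (Pair k -` B) \<partial>distr M borel \<kappa>)"
  proof (rule Q.emeasure_pair_measure_alt)
    show "B \<in> sets (distr M borel \<kappa> \<Otimes>\<^sub>M ?Q)"
      using B by (metis sets_pair_measure_cong sets_distr)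
  qed
  also have "\<dots> \<le> (\<integral>\<^sup>+k. ennreal c \<partial>distr M borel \<kappa>)"
  proof (rule nn_integral_mono)
    fix k
    have "Pair k -` B = {x \<in> space ?Q. (k, x) \<in> B}"
      using sets.sets_into_space[OF B] by (auto simp: space_pair_measure)
    then show "emeasure ?Q (Pair k -` B) \<le> ennreal c"
      using c[of k] by (simp add: Q.emeasure_eq_measure ennreal_leI)
  qed
  also have "\<dots> = ennreal c" using \<kappa>.emeasure_space_1 by simp
  finally show "measure M {\<omega> \<in> space M. (\<kappa> \<omega>, ?X \<omega>) \<in> B} \<le> c"
    using c0 by (simp add: emeasure_eq_measure)
qed

section \<open>The good event for the clean sample and its probability\<close>

context shrinkage
begin

text \<open>Centring at \<open>mean P - \<kappa>\<close> instead of the expectation keeps the second moment below free of the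
  term \<open>R\<^sup>q\<close>: it splits into a central moment of \<open>X\<close> and \<open>R\<^sup>2 * G \<kappa> a\<close>.\<close>

definition residual :: "real \<Rightarrow> real \<Rightarrow> real \<Rightarrow> real" where
  "residual \<kappa> a x = (x - \<kappa>) * w (a * \<bar>x - \<kappa>\<bar>) - (mean P - \<kappa>)"

definition bias :: "real \<Rightarrow> real \<Rightarrow> real" where
  "bias \<kappa> a = \<bar>\<integral>x. residual \<kappa> a x \<partial>P\<bar>"

definition spread :: "real \<Rightarrow> real \<Rightarrow> real" where
  "spread \<kappa> a = (\<integral>x. (residual \<kappa> a x)\<^sup>2 \<partial>P)"

text \<open>The threshold of \<open>bernstein_two_sided\<close> for
  \<open>residual \<kappa> a\<close>, with the uniform bound of \<open>abs_residual_le\<close> as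
  \<open>b\<close>.\<close>

definition deviation :: "nat \<Rightarrow> real \<Rightarrow> real \<Rightarrow> real \<Rightarrow> real" where
  "deviation n L \<kappa> a = real n * bias \<kappa> a
    + 3 * L * max (K / a + \<bar>\<kappa> - mean P\<bar>) (sqrt (real n * spread \<kappa> a / L))"

text \<open>The levels make the expected deficit sums t / 26 and 6 s; the event keeps the actual
  sums below t and above s, so that up to n \<epsilon> alterations still leave them on the two sides
  of \<eta>. The bound 14 s controls the cost of moving the scale. The implication is vacuous when 6
  s / n \<ge> 1, where no level in the range of the level lemmas is available.\<close>

definition good_sample :: "nat \<Rightarrow> real \<Rightarrow> real \<Rightarrow> real \<Rightarrow> real \<Rightarrow> (nat \<Rightarrow> real) \<Rightarrow> bool" where
  "good_sample n L t s \<kappa> x \<longleftrightarrow>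
    (\<Sum>i<n. 1 - w (level (t / (26 * real n)) \<kappa> * \<bar>x i - \<kappa>\<bar>)) < t \<and>
    \<bar>\<Sum>i<n. residual \<kappa> (level (t / (26 * real n)) \<kappa>) (x i)\<bar> < deviation n L \<kappa> (level (t / (26 * real n)) \<kappa>) \<and>
    (6 * s < real n \<longrightarrow>
      s < (\<Sum>i<n. 1 - w (level (6 * s / real n) \<kappa> * \<bar>x i - \<kappa>\<bar>)) \<and>
      (\<Sum>i<n. 1 - w (level (6 * s / real n) \<kappa> * \<bar>x i - \<kappa>\<bar>)) < 14 * s)"

lemma abs_residual_le:
  assumes "0 < a"
  shows "\<bar>residual \<kappa> a x\<bar> \<le> K / a + \<bar>\<kappa> - mean P\<bar>"
proof -
  have "\<bar>(x - \<kappa>) * w (a * \<bar>x - \<kappa>\<bar>)\<bar> \<le> K / a"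
    using abs_mult_w_le[OF assms, of "x - \<kappa>"] w_nonneg[of "a * \<bar>x - \<kappa>\<bar>"] assms
    by (simp add: abs_mult)
  then show ?thesis unfolding residual_def by linarith
qed

lemma measurable_residual: "0 \<le> a \<Longrightarrow> residual \<kappa> a \<in> borel_measurable borel"
  unfolding residual_def[abs_def] by measurable

text \<open>The three deficit tails use the rates 3, -1 and 1, and the constants 26, 6 and 14 are
  chosen for them: e \<le> 3 gives e^3 - 1 \<le> 26 and exponent t - 3 t; 1 / e \<le> 1 / 2 gives -3
  s + s; e - 1 \<le> 2 gives 12 s - 14 s. Each exponent is at most -2 L. Bernstein contributes the
  other two of the five terms.\<close>

lemma prob_not_good_sample:
  assumes L: "0 < L" "L \<le> t" "L \<le> s" and t: "t \<le> real n"
  shows "measure (PiM {..<n} (\<lambda>_. P)) {x \<in> space (PiM {..<n} (\<lambda>_. P)). \<not> good_sample n L t s \<kappa> x}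
    \<le> 5 * exp (- 2 * L)"
proof -
  let ?Q = "PiM {..<n} (\<lambda>_. P)"
  interpret Q: prob_space ?Q by (rule prob_space_PiM) (rule prob_space_axioms)
  define a where "a = level (t / (26 * real n)) \<kappa>"
  have n: "0 < real n" using L t by linarith
  have g: "0 < t / (26 * real n)" "t / (26 * real n) < 1" using L t n by (auto simp: field_simps)
  have a: "0 < a" "G \<kappa> a = t / (26 * real n)"
    using level_pos[OF g] G_level[OF g] by (auto simp: a_def)
  have e1: "2 \<le> exp (1::real)" using exp_ge_add_one_self[of "1::real"] by simp
  have e2: "exp (1::real) \<le> 3" by (rule exp_le)
  have e3: "exp (3::real) \<le> 27"
  proof -
    have "exp (3::real) = exp 1 ^ 3" by (simp add: exp_of_nat_mult[symmetric])
    also have "\<dots> \<le> 3 ^ 3" by (intro power_mono e2) auto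
    finally show ?thesis by simp
  qed
  have e4: "exp (-1::real) \<le> 1 / 2" using e1 by (simp add: exp_minus field_simps)
  define E1 where "E1 = {x \<in> space ?Q. 3 * t \<le> 3 * (\<Sum>i<n. 1 - w (a * \<bar>x i - \<kappa>\<bar>))}"
  define E2 where "E2 = {x \<in> space ?Q. deviation n L \<kappa> a \<le> \<bar>\<Sum>i<n. residual \<kappa> a (x i)\<bar>}"
  \<comment> \<open>The default 0 keeps the scale non-negative, hence the weights measurable; the
    events that mention it are then empty.\<close>
  define b where "b = (if 6 * s < real n then level (6 * s / real n) \<kappa> else 0)"
  define E3 where "E3 = (if 6 * s < real n then {x \<in> space ?Q. - s \<le> -1 * (\<Sum>i<n. 1 - w (b * \<bar>x i - \<kappa>\<bar>))} else {})"
  define E4 where "E4 = (if 6 * s < real n then {x \<in> space ?Q. 14 * s \<le> 1 * (\<Sum>i<n. 1 - w (b * \<bar>x i - \<kappa>\<bar>))} else {})"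
  have b: "0 \<le> b" "6 * s < real n \<Longrightarrow> G \<kappa> b = 6 * s / real n"
  proof -
    have gs: "0 < 6 * s / real n" "6 * s / real n < 1" if "6 * s < real n"
      using L that n by (auto simp: field_simps)
    show "0 \<le> b" "6 * s < real n \<Longrightarrow> G \<kappa> b = 6 * s / real n"
      using level_nonneg[OF gs] G_level[OF gs] by (auto simp: b_def)
  qed
  have sets: "E1 \<in> sets ?Q" "E2 \<in> sets ?Q" "E3 \<in> sets ?Q" "E4 \<in> sets ?Q"
  proof -
    have m: "{x \<in> space ?Q. u \<le> c * (\<Sum>i<n. f (x i))} \<in> sets ?Q"
      if [measurable]: "f \<in> borel_measurable borel" for f :: "real \<Rightarrow> real" and u c
      by measurable
    have d: "(\<lambda>x. 1 - w (a * \<bar>x - \<kappa>\<bar>)) \<in> borel_measurable borel"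
      "(\<lambda>x. 1 - w (b * \<bar>x - \<kappa>\<bar>)) \<in> borel_measurable borel"
      using a b by auto
    have [measurable]: "residual \<kappa> a \<in> borel_measurable borel"
      using a by (intro measurable_residual) simp
    show "E1 \<in> sets ?Q" unfolding E1_def by (rule m[OF d(1)])
    show "E3 \<in> sets ?Q" "E4 \<in> sets ?Q"
      unfolding E3_def E4_def using m[OF d(2), of "- s" "- 1"] m[OF d(2), of "14 * s" 1] by auto
    show "E2 \<in> sets ?Q" unfolding E2_def by measurable
  qed
  have m1: "measure ?Q E1 \<le> exp (- 2 * L)"
  proof -
    have "measure ?Q E1 \<le> exp (real n * ((exp 3 - 1) * G \<kappa> a) - 3 * t)"
      unfolding E1_def using a by (intro deficit_tail) auto
    also have "\<dots> \<le> exp (- 2 * L)"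
    proof -
      have "real n * ((exp 3 - 1) * G \<kappa> a) = (exp 3 - 1) * (t / 26)" using a n by simp
      also have "\<dots> \<le> 26 * (t / 26)" using e3 L by (intro mult_right_mono) auto
      finally show ?thesis using L by simp
    qed
    finally show ?thesis .
  qed
  have m2: "measure ?Q E2 \<le> 2 * exp (- 2 * L)"
    unfolding E2_def deviation_def
  proof (rule bernstein_two_sided)
    show "prob_space P" by (rule prob_space_axioms)
    show "residual \<kappa> a \<in> borel_measurable P" using measurable_residual[of a \<kappa>] a by simp
    show "0 < K / a + \<bar>\<kappa> - mean P\<bar>" using K_ge_1 a by (intro add_pos_nonneg divide_pos_pos) auto
    show "\<bar>residual \<kappa> a x\<bar> \<le> K / a + \<bar>\<kappa> - mean P\<bar>" for x by (rule abs_residual_le) fact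
  qed (use L in \<open>auto simp: bias_def spread_def\<close>)
  have m3: "measure ?Q E3 \<le> exp (- 2 * L)"
  proof (cases "6 * s < real n")
    case True
    have "measure ?Q E3 \<le> exp (real n * ((exp (-1) - 1) * G \<kappa> b) - (- s))"
      unfolding E3_def if_P[OF True] using b by (intro deficit_tail) auto
    also have "\<dots> \<le> exp (- 2 * L)"
    proof -
      have "real n * ((exp (-1) - 1) * G \<kappa> b) = (exp (-1) - 1) * (6 * s)" using b True n by simp
      also have "\<dots> \<le> (- 1 / 2) * (6 * s)" using e4 L by (intro mult_right_mono) auto
      finally show ?thesis using L by simp
    qed
    finally show ?thesis .
  qed (simp add: E3_def)
  have m4: "measure ?Q E4 \<le> exp (- 2 * L)"
  proof (cases "6 * s < real n")
    case True
    have "measure ?Q E4 \<le> exp (real n * ((exp 1 - 1) * G \<kappa> b) - 14 * s)"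
      unfolding E4_def if_P[OF True] using b by (intro deficit_tail) auto
    also have "\<dots> \<le> exp (- 2 * L)"
    proof -
      have "real n * ((exp 1 - 1) * G \<kappa> b) = (exp 1 - 1) * (6 * s)" using b True n by simp
      also have "\<dots> \<le> 2 * (6 * s)" using e2 L by (intro mult_right_mono) auto
      finally show ?thesis using L by simp
    qed
    finally show ?thesis .
  qed (simp add: E4_def)
  have "measure ?Q {x \<in> space ?Q. \<not> good_sample n L t s \<kappa> x} \<le> measure ?Q ((E1 \<union> E2) \<union> (E3 \<union> E4))"
  proof (rule Q.finite_measure_mono)
    show "{x \<in> space ?Q. \<not> good_sample n L t s \<kappa> x} \<subseteq> (E1 \<union> E2) \<union> (E3 \<union> E4)"
      by (auto simp: good_sample_def E1_def E2_def E3_def E4_def b_def a_def[symmetric] not_less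
          simp del: sum_subtractf)
  qed (use sets in auto)
  also have "\<dots> \<le> (measure ?Q E1 + measure ?Q E2) + (measure ?Q E3 + measure ?Q E4)"
    using sets by (intro order.trans[OF measure_Un_le] add_mono measure_Un_le) auto
  finally show ?thesis using m1 m2 m3 m4 by simp
qed

lemma measurable_w_level:
  assumes g: "0 < g" "g < 1" and [measurable]: "k \<in> borel_measurable N" "h \<in> borel_measurable N"
  shows "(\<lambda>z. w (level g (k z) * \<bar>h z\<bar>)) \<in> borel_measurable N"
proof -
  note [measurable] = measurable_level[OF g]
  have "(\<lambda>z. w (level g (k z) * \<bar>h z\<bar>)) = (\<lambda>z. W (level g (k z) * \<bar>h z\<bar>))"
    using level_nonneg[OF g] by (simp add: W_eq)
  then show ?thesis by simp
qed

text \<open>Fubini needs measurability jointly in the base estimate and the sample. The base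
  estimate enters both as centre and through the level, so \<open>bias\<close> and
  \<open>spread\<close> have to be measurable along the level as well.\<close>

lemma measurable_not_good_sample:
  assumes L: "0 < L" "L \<le> t" "L \<le> s" and t: "t \<le> real n"
  shows "{z \<in> space (borel \<Otimes>\<^sub>M PiM {..<n} (\<lambda>_. P)). \<not> good_sample n L t s (fst z) (snd z)}
    \<in> sets (borel \<Otimes>\<^sub>M PiM {..<n} (\<lambda>_. P))"
proof -
  define g where "g = t / (26 * real n)"
  have n: "0 < real n" using L t by linarith
  have g: "0 < g" "g < 1" using L t n by (auto simp: g_def field_simps)
  note [measurable] = measurable_level[OF g] measurable_w_level[OF g]
  have res[measurable]: "(\<lambda>z. residual (k z) (level g (k z)) (h z)) \<in> borel_measurable N"
    if [measurable]: "k \<in> borel_measurable N" "h \<in> borel_measurable N" for k h and N :: "'c measure"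
    unfolding residual_def by measurable
  have [measurable]: "(\<lambda>\<kappa>. bias \<kappa> (level g \<kappa>)) \<in> borel_measurable borel"
    unfolding bias_def by (intro borel_measurable_abs borel_measurable_lebesgue_integral) measurable
  have [measurable]: "(\<lambda>\<kappa>. spread \<kappa> (level g \<kappa>)) \<in> borel_measurable borel"
    unfolding spread_def by (intro borel_measurable_lebesgue_integral) measurable
  have [measurable]: "(\<lambda>\<kappa>. deviation n L \<kappa> (level g \<kappa>)) \<in> borel_measurable borel"
    unfolding deviation_def by measurable
  let ?N = "borel \<Otimes>\<^sub>M PiM {..<n} (\<lambda>_. P)"
  show ?thesis
  proof (cases "6 * s < real n")
    case True
    define g' where "g' = 6 * s / real n"
    have g': "0 < g'" "g' < 1" using L True n by (auto simp: g'_def field_simps)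
    note [measurable] = measurable_w_level[OF g']
    show ?thesis
      unfolding good_sample_def g_def[symmetric] g'_def[symmetric] by measurable
  next
    \<comment> \<open>The argument 6 s / n is outside the range in which
      \<open>measurable_level\<close> applies, so the vacuous clause is rewritten away
      first.\<close>
    case False
    then have eq: "(6 * s < real n \<longrightarrow> A) \<longleftrightarrow> True" for A by simp
    show ?thesis
      unfolding good_sample_def g_def[symmetric] eq by measurable
  qed
qed

end

section \<open>Moment bounds\<close>

lemma add_powr_le:
  fixes x y a :: real
  assumes "0 \<le> x" "0 \<le> y" "0 < a"
  shows "(x + y) powr a \<le> 2 powr a * (x powr a + y powr a)"
proof -
  have "(x + y) powr a \<le> (2 * max x y) powr a"
    using assms by (intro powr_mono2) auto
  also have "\<dots> = 2 powr a * max x y powr a"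
    using assms by (simp add: powr_mult)
  also have "\<dots> \<le> 2 powr a * (x powr a + y powr a)"
    by (intro mult_left_mono) (auto simp: max_def)
  finally show ?thesis .
qed

text \<open>After normalising to x + y = 1, each share z lies in [0, 1] and satisfies z \<le> z^a.
  This is what later separates the central moment from \<open>R\<close> without an extra
  constant.\<close>

lemma powr_add_le_add_powr:
  fixes x y a :: real
  assumes "0 \<le> x" "0 \<le> y" "0 < a" "a \<le> 1"
  shows "(x + y) powr a \<le> x powr a + y powr a"
proof (cases "x + y = 0")
  case False
  define s where "s = x + y"
  have s: "0 < s" using False assms by (simp add: s_def)
  have le: "z / s \<le> (z / s) powr a" if "0 \<le> z" "z \<le> s" for z
    using powr_mono'[of a 1 "z / s"] that s assms by simp
  have "s powr a = s powr a * (x / s + y / s)"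
    using s by (simp add: s_def add_divide_distrib[symmetric])
  also have "\<dots> \<le> s powr a * ((x / s) powr a + (y / s) powr a)"
    using assms by (intro mult_left_mono add_mono le) (auto simp: s_def)
  also have "\<dots> = x powr a + y powr a"
    using s assms by (simp add: powr_divide distrib_left)
  finally show ?thesis by (simp add: s_def)
qed (use assms in simp)

locale shrinkage_moment = shrinkage w K P
  for w :: "real \<Rightarrow> real" and K :: real and P :: "real measure" +
  fixes p :: real
  assumes p_gt_1: "1 < p"
    and w_ge: "\<And>t. 0 \<le> t \<Longrightarrow> max (1 - t powr p) 0 \<le> w t"
    and moment: "integrable P (\<lambda>x. \<bar>x\<bar> powr p)"
begin

lemma integrable_powr_diff:
  assumes "0 < q" "q \<le> p"
  shows "integrable P (\<lambda>x. \<bar>x - c\<bar> powr q)"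
proof (rule Bochner_Integration.integrable_bound)
  show "integrable P (\<lambda>x. 1 + 2 powr p * (\<bar>x\<bar> powr p + \<bar>c\<bar> powr p))"
    using moment by auto
  have "\<bar>x - c\<bar> powr q \<le> 1 + 2 powr p * (\<bar>x\<bar> powr p + \<bar>c\<bar> powr p)" for x
  proof -
    have "\<bar>x - c\<bar> powr q \<le> 1 + \<bar>x - c\<bar> powr p"
    proof (cases "\<bar>x - c\<bar> \<le> 1")
      case True
      then show ?thesis using powr_le1[of q "\<bar>x - c\<bar>"] assms by (smt (verit) powr_ge_zero)
    next
      case False
      then have "\<bar>x - c\<bar> powr q \<le> \<bar>x - c\<bar> powr p" using assms by (intro powr_mono) auto
      then show ?thesis by simp
    qed
    also have "\<bar>x - c\<bar> powr p \<le> (\<bar>x\<bar> + \<bar>c\<bar>) powr p"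
      using p_gt_1 by (intro powr_mono2) auto
    also have "\<dots> \<le> 2 powr p * (\<bar>x\<bar> powr p + \<bar>c\<bar> powr p)"
      using p_gt_1 by (intro add_powr_le) auto
    finally show ?thesis by simp
  qed
  then show "AE x in P. norm (\<bar>x - c\<bar> powr q) \<le> norm (1 + 2 powr p * (\<bar>x\<bar> powr p + \<bar>c\<bar> powr p))"
    by (intro AE_I2) (simp add: abs_of_nonneg)
qed simp

lemma integrable_diff: "integrable P (\<lambda>x. x - c)"
proof (rule Bochner_Integration.integrable_bound)
  show "integrable P (\<lambda>x. \<bar>x - c\<bar> powr 1)"
    using p_gt_1 by (intro integrable_powr_diff) auto
qed auto

lemma nu_nonneg: "0 \<le> nu P q"
  by (simp add: nu_def)

lemma nu_powr: "0 < q \<Longrightarrow> nu P q powr q = (\<integral>x. \<bar>x - mean P\<bar> powr q \<partial>P)"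
  by (simp add: nu_def powr_powr integral_nonneg_AE)

text \<open>Moving the centre from \<kappa> to the mean costs \<open>R\<close> and the factor 2.
  Superadditivity of the q-th power then collects both terms in one power of nu + R.\<close>

lemma moment_le:
  assumes q: "1 < q" "q \<le> p" and R: "\<bar>\<kappa> - mean P\<bar> \<le> R"
  shows "(\<integral>x. \<bar>x - \<kappa>\<bar> powr q \<partial>P) \<le> (2 * (nu P q + R)) powr q"
proof -
  have "\<bar>x - \<kappa>\<bar> powr q \<le> 2 powr q * (\<bar>x - mean P\<bar> powr q + R powr q)" for x
  proof -
    have "\<bar>x - \<kappa>\<bar> powr q \<le> (\<bar>x - mean P\<bar> + R) powr q"
      using R q by (intro powr_mono2) auto
    also have "\<dots> \<le> 2 powr q * (\<bar>x - mean P\<bar> powr q + R powr q)"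
      using R q by (intro add_powr_le) auto
    finally show ?thesis .
  qed
  then have "(\<integral>x. \<bar>x - \<kappa>\<bar> powr q \<partial>P) \<le> (\<integral>x. 2 powr q * (\<bar>x - mean P\<bar> powr q + R powr q) \<partial>P)"
    using q by (intro integral_mono integrable_powr_diff integrable_mult_right Bochner_Integration.integrable_add) auto
  also have "\<dots> = 2 powr q * (nu P q powr q + R powr q)"
    using q integrable_powr_diff[of q "mean P"] by (simp add: nu_powr)
  also have "nu P q powr q + R powr q \<le> (nu P q + R) powr q"
  proof -
    have "nu P q powr q + R powr q = nu P q * nu P q powr (q - 1) + R * R powr (q - 1)"
      using R nu_nonneg[of q] by (simp add: powr_mult_base)
    also have "\<dots> \<le> nu P q * (nu P q + R) powr (q - 1) + R * (nu P q + R) powr (q - 1)"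
      using R nu_nonneg[of q] q by (intro add_mono mult_left_mono powr_mono2) auto
    also have "\<dots> = (nu P q + R) powr q"
      using R nu_nonneg[of q] by (simp add: distrib_right[symmetric] powr_mult_base)
    finally show ?thesis .
  qed
  finally show ?thesis
    using R nu_nonneg[of q] by (subst powr_mult) auto
qed

text \<open>The lower bound on \<open>w\<close> at the single exponent \<open>p\<close> serves all
  smaller ones: t^p \<le> t^q for t \<le> 1, while beyond 1 the deficit is at most 1 \<le>
  t^q.\<close>

lemma deficit_le_powr:
  assumes q: "0 < q" "q \<le> p" and t: "0 \<le> t"
  shows "1 - w t \<le> t powr q"
proof (cases "t \<le> 1")
  case True
  have "1 - w t \<le> t powr p" using w_ge[OF t] by simp
  also have "\<dots> \<le> t powr q" using True t q by (intro powr_mono') auto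
  finally show ?thesis .
next
  case False
  then have "1 \<le> t powr q" using q by (intro ge_one_powr_ge_zero) auto
  then show ?thesis using w_nonneg[OF t] by simp
qed

context
  fixes q \<kappa> R a :: real
  assumes q: "1 < q" "q \<le> p" and R: "\<bar>\<kappa> - mean P\<bar> \<le> R" and a: "0 < a" and G: "0 < G \<kappa> a"
begin

lemma G_le: "G \<kappa> a \<le> (a * (2 * (nu P q + R))) powr q"
proof -
  have "G \<kappa> a \<le> (\<integral>x. a powr q * \<bar>x - \<kappa>\<bar> powr q \<partial>P)"
    unfolding G_def
  proof (rule integral_mono)
    show "1 - w (a * \<bar>x - \<kappa>\<bar>) \<le> a powr q * \<bar>x - \<kappa>\<bar> powr q" for x
      using deficit_le_powr[of q "a * \<bar>x - \<kappa>\<bar>"] q a by (simp add: powr_mult)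
  qed (use q a in \<open>auto intro!: integrable_deficit integrable_powr_diff\<close>)
  also have "\<dots> = a powr q * (\<integral>x. \<bar>x - \<kappa>\<bar> powr q \<partial>P)" by simp
  also have "\<dots> \<le> a powr q * (2 * (nu P q + R)) powr q"
    using moment_le[OF q R] by (intro mult_left_mono) auto
  finally show ?thesis using a R nu_nonneg[of q] by (simp add: powr_mult)
qed

text \<open>A positive deficit excludes a point mass at \<kappa>. Strict positivity makes the
  truncation threshold in \<open>bias_le\<close> a legitimate positive number.\<close>

lemma nu_plus_R_pos: "0 < nu P q + R"
proof (rule ccontr)
  assume "\<not> ?thesis"
  then have "nu P q + R = 0" using nu_nonneg[of q] R by linarith
  then show False using G_le G q by simp
qed

lemma inverse_level_le: "1 / a \<le> 2 * (nu P q + R) * G \<kappa> a powr (- 1 / q)"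
proof -
  have "G \<kappa> a powr (1 / q) \<le> ((a * (2 * (nu P q + R))) powr q) powr (1 / q)"
    using G_le G q by (intro powr_mono2) auto
  also have "\<dots> = a * (2 * (nu P q + R))"
    using q a nu_plus_R_pos by (simp add: powr_powr)
  finally show ?thesis
    using a G by (simp add: powr_minus field_simps)
qed

text \<open>The residual is x - mean, which integrates to 0, minus (x - \<kappa>) times the deficit.
  At the threshold \<open>A\<close> both parts of the truncated bound equal m g^(1 - 1/q); with m =
  2 (nu + R) this gives the constant 4.\<close>

lemma bias_le: "bias \<kappa> a \<le> 4 * (nu P q + R) * G \<kappa> a powr (1 - 1 / q)"
proof -
  define g where "g = G \<kappa> a"
  define m where "m = 2 * (nu P q + R)"
  define A where "A = m * g powr (- 1 / q)"
  have g: "0 < g" using G by (simp add: g_def)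
  have m: "0 < m" using nu_plus_R_pos by (simp add: m_def)
  have A: "0 < A" using g m by (simp add: A_def)
  let ?f = "\<lambda>x. 1 - w (a * \<bar>x - \<kappa>\<bar>)"
  have f: "0 \<le> ?f x" "?f x \<le> 1" for x using deficit_bounds[of a] a by auto
  have meas[measurable]: "(\<lambda>x. (x - \<kappa>) * ?f x) \<in> borel_measurable P" using a by simp
  have int: "integrable P (\<lambda>x. (x - \<kappa>) * ?f x)"
    by (rule Bochner_Integration.integrable_bound[OF integrable_diff[of \<kappa>] meas])
      (use f in \<open>auto simp: abs_mult mult_left_le\<close>)
  \<comment> \<open>Truncating at the balancing threshold \<open>A\<close> replaces Hoelder's inequality.\<close>
  have pw: "\<bar>(x - \<kappa>) * ?f x\<bar> \<le> A * ?f x + A powr (1 - q) * \<bar>x - \<kappa>\<bar> powr q" for x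
  proof (cases "\<bar>x - \<kappa>\<bar> \<le> A")
    case True
    then have "\<bar>x - \<kappa>\<bar> * ?f x \<le> A * ?f x" using f by (intro mult_right_mono) auto
    then show ?thesis using f[of x] by (simp add: abs_mult add_increasing2)
  next
    case False
    then have pos: "0 < \<bar>x - \<kappa>\<bar>" using A by linarith
    have "\<bar>x - \<kappa>\<bar> * ?f x \<le> \<bar>x - \<kappa>\<bar>" using f[of x] by (simp add: mult_left_le)
    also have "\<dots> = \<bar>x - \<kappa>\<bar> powr (1 - q) * \<bar>x - \<kappa>\<bar> powr q"
      using pos by (simp add: powr_add[symmetric])
    also have "\<dots> \<le> A powr (1 - q) * \<bar>x - \<kappa>\<bar> powr q"
      using False A q by (intro mult_right_mono powr_mono2') auto
    finally show ?thesis using f[of x] A by (simp add: abs_mult add_increasing)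
  qed
  have "(\<integral>x. residual \<kappa> a x \<partial>P) = (\<integral>x. (x - mean P) - (x - \<kappa>) * ?f x \<partial>P)"
    by (rule Bochner_Integration.integral_cong) (auto simp: residual_def algebra_simps)
  also have "\<dots> = (\<integral>x. x - mean P \<partial>P) - (\<integral>x. (x - \<kappa>) * ?f x \<partial>P)"
    by (rule Bochner_Integration.integral_diff[OF integrable_diff int])
  also have "(\<integral>x. x - mean P \<partial>P) = 0"
    using integrable_diff[of 0] by (simp add: mean_def)
  finally have "bias \<kappa> a = \<bar>\<integral>x. (x - \<kappa>) * ?f x \<partial>P\<bar>"
    by (simp add: bias_def)
  also have "\<dots> \<le> (\<integral>x. \<bar>(x - \<kappa>) * ?f x\<bar> \<partial>P)"
    by (rule integral_abs_bound)
  also have "\<dots> \<le> (\<integral>x. A * ?f x + A powr (1 - q) * \<bar>x - \<kappa>\<bar> powr q \<partial>P)"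
    using int pw q a
    by (intro integral_mono integrable_abs Bochner_Integration.integrable_add integrable_mult_right
        integrable_deficit integrable_powr_diff) auto
  also have "\<dots> = A * g + A powr (1 - q) * (\<integral>x. \<bar>x - \<kappa>\<bar> powr q \<partial>P)"
  proof -
    have "integrable P (\<lambda>x. A * ?f x)" "integrable P (\<lambda>x. A powr (1 - q) * \<bar>x - \<kappa>\<bar> powr q)"
      using q a by (intro integrable_mult_right integrable_deficit integrable_powr_diff; simp)+
    then show ?thesis
      by (subst Bochner_Integration.integral_add)
        (simp_all add: g_def G_def del: Bochner_Integration.integral_diff)
  qed
  also have "\<dots> \<le> A * g + A powr (1 - q) * m powr q"
    unfolding m_def by (intro add_left_mono mult_left_mono moment_le q R) auto
  also have "A * g = m * g powr (1 - 1 / q)"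
    using g by (simp add: A_def powr_diff powr_minus field_simps)
  also have "A powr (1 - q) * m powr q = m * g powr (1 - 1 / q)"
  proof -
    have "A powr (1 - q) = m powr (1 - q) * g powr (- 1 / q * (1 - q))"
      using g m by (simp add: A_def powr_mult powr_powr)
    moreover have "- 1 / q * (1 - q) = 1 - 1 / q" using q by (simp add: field_simps)
    moreover have "m powr (1 - q) * m powr q = m" using m by (simp add: powr_add[symmetric])
    ultimately show ?thesis by (metis mult.assoc mult.commute)
  qed
  finally show ?thesis by (simp add: m_def g_def algebra_simps)
qed

text \<open>Split the residual as u - v with u = (x - mean) w and v = (mean - \<kappa>)(1 - w). As
  \<bar>u\<bar> is at most both K / a + R and \<bar>x - mean\<bar>, writing u^2 as \<bar>u\<bar>^(2
  - q) \<bar>u\<bar>^q requires only a central q-th moment. For v the squared deficit is at most the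
  deficit, whose mean is \<open>G \<kappa> a\<close>.\<close>

lemma spread_le:
  assumes q2: "q \<le> 2"
  shows "spread \<kappa> a \<le> 2 * ((K / a + R) powr (2 - q) * nu P q powr q) + 2 * (R\<^sup>2 * G \<kappa> a)"
proof -
  let ?f = "\<lambda>x. 1 - w (a * \<bar>x - \<kappa>\<bar>)"
  define B where "B = K / a + R"
  have B: "0 < B" using K_ge_1 a R by (auto simp: B_def intro!: add_pos_nonneg)
  have f: "0 \<le> ?f x" "?f x \<le> 1" for x using deficit_bounds[of a] a by auto
  have pw: "(residual \<kappa> a x)\<^sup>2 \<le> 2 * (B powr (2 - q) * \<bar>x - mean P\<bar> powr q) + 2 * (R\<^sup>2 * ?f x)" for x
  proof -
    define u where "u = (x - mean P) * w (a * \<bar>x - \<kappa>\<bar>)"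
    define v where "v = (mean P - \<kappa>) * ?f x"
    have w01: "0 \<le> w (a * \<bar>x - \<kappa>\<bar>)" "w (a * \<bar>x - \<kappa>\<bar>) \<le> 1" using f[of x] a by (auto intro!: w_nonneg)
    have res: "residual \<kappa> a x = u - v"
      by (simp add: residual_def u_def v_def algebra_simps)
    have "\<bar>u\<bar> = \<bar>x - mean P\<bar> * w (a * \<bar>x - \<kappa>\<bar>)" using w01 by (simp add: u_def abs_mult)
    also have "\<dots> \<le> (\<bar>x - \<kappa>\<bar> + R) * w (a * \<bar>x - \<kappa>\<bar>)"
      using R w01 by (intro mult_right_mono) auto
    also have "\<dots> \<le> B"
      using abs_mult_w_le[OF a, of "x - \<kappa>"] mult_left_le[OF w01(2), of R] abs_ge_zero[THEN order.trans, OF R]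
      by (simp add: B_def distrib_right)
    finally have uB: "\<bar>u\<bar> \<le> B" .
    have ux: "\<bar>u\<bar> \<le> \<bar>x - mean P\<bar>" using w01 by (simp add: u_def abs_mult mult_left_le)
    have "u\<^sup>2 \<le> B powr (2 - q) * \<bar>x - mean P\<bar> powr q"
    proof (cases "u = 0")
      case False
      have "u\<^sup>2 = \<bar>u\<bar> powr 2" using False by simp
      also have "\<dots> = \<bar>u\<bar> powr (2 - q) * \<bar>u\<bar> powr q" by (simp add: powr_add[symmetric])
      also have "\<dots> \<le> B powr (2 - q) * \<bar>x - mean P\<bar> powr q"
        using uB ux q q2 by (intro mult_mono powr_mono2) auto
      finally show ?thesis .
    qed simp
    moreover have "v\<^sup>2 \<le> R\<^sup>2 * ?f x"
    proof -
      have "v\<^sup>2 = (mean P - \<kappa>)\<^sup>2 * (?f x)\<^sup>2" by (simp add: v_def power_mult_distrib)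
      also have "\<dots> \<le> R\<^sup>2 * ?f x"
        using R f[of x] by (intro mult_mono) (auto simp: power2_eq_square mult_left_le abs_le_square_iff[symmetric] abs_minus_commute
            intro!: power2_le_iff_abs_le[THEN iffD2, unfolded power2_eq_square])
      finally show ?thesis .
    qed
    moreover have "(u - v)\<^sup>2 \<le> 2 * u\<^sup>2 + 2 * v\<^sup>2"
      using zero_le_power2[of "u + v"] by (simp add: power2_eq_square algebra_simps)
    ultimately show ?thesis unfolding res by linarith
  qed
  have i1: "integrable P (\<lambda>x. 2 * (B powr (2 - q) * \<bar>x - mean P\<bar> powr q))"
    using q by (intro integrable_mult_right integrable_powr_diff) auto
  have i2: "integrable P (\<lambda>x. 2 * (R\<^sup>2 * ?f x))"
    using a by (intro integrable_mult_right integrable_deficit) auto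
  have meas: "residual \<kappa> a \<in> borel_measurable P"
    using measurable_residual[of a \<kappa>] a by simp
  have "spread \<kappa> a \<le> (\<integral>x. 2 * (B powr (2 - q) * \<bar>x - mean P\<bar> powr q) + 2 * (R\<^sup>2 * ?f x) \<partial>P)"
    unfolding spread_def
  proof (rule integral_mono)
    show "integrable P (\<lambda>x. (residual \<kappa> a x)\<^sup>2)"
      by (rule Bochner_Integration.integrable_bound[OF Bochner_Integration.integrable_add[OF i1 i2]])
        (use meas in simp, intro AE_I2, use pw in \<open>auto intro: order.trans[OF _ abs_ge_self]\<close>)
  qed (use i1 i2 pw in auto)
  also have "\<dots> = 2 * (B powr (2 - q) * nu P q powr q) + 2 * (R\<^sup>2 * G \<kappa> a)"
    using q by (subst Bochner_Integration.integral_add[OF i1 i2])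
      (simp add: nu_powr G_def del: Bochner_Integration.integral_diff)
  finally show ?thesis by (simp add: B_def)
qed

end

end

section \<open>Error bounds on the good event\<close>

text \<open>This produces the mixed term of the first infimum, with \<open>Y\<close> standing for K
  / a + R. Raising the bound on \<open>Y\<close> to the power 1 - q/2 and multiplying by sqrt l
  gives the exponent -(1 - q/2)/q + 1/2 = 1 - 1/q. At q = 2 the power of \<open>Y\<close> is 1, and
  the convention in \<open>rpow\<close> matters.\<close>

lemma interpolation_bound:
  fixes \<nu> R c l Y q :: real
  assumes nonneg: "0 \<le> \<nu>" "0 \<le> R" and c: "1 \<le> c" and l: "0 < l" and q: "1 < q" "q \<le> 2"
    and Y: "0 < Y" "Y \<le> c * (\<nu> + R) * l powr (- 1 / q)"
  shows "Y powr (1 - q / 2) * \<nu> powr (q / 2) * sqrt l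
    \<le> c * (\<nu> + \<nu> powr (q / 2) * rpow R (1 - q / 2)) * l powr (1 - 1 / q)"
proof (cases "q = 2")
  case True
  have "\<nu> * sqrt l \<le> (c * (2 * \<nu>)) * sqrt l"
    using nonneg c l mult_right_mono[of 1 "c * 2" \<nu>] by (intro mult_right_mono) auto
  then show ?thesis using True Y nonneg l by (simp add: rpow_def powr_half_sqrt mult_ac)
next
  case False
  define \<sigma> where "\<sigma> = 1 - q / 2"
  have \<sigma>: "0 < \<sigma>" "\<sigma> \<le> 1" using False q by (auto simp: \<sigma>_def)
  have "Y powr \<sigma> \<le> (c * (\<nu> + R) * l powr (- 1 / q)) powr \<sigma>"
    using Y \<sigma> by (intro powr_mono2) auto
  also have "\<dots> = c powr \<sigma> * (\<nu> + R) powr \<sigma> * l powr (- \<sigma> / q)"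
    using nonneg c l by (simp add: powr_mult powr_powr)
  also have "\<dots> \<le> c * (\<nu> powr \<sigma> + R powr \<sigma>) * l powr (- \<sigma> / q)"
  proof -
    have "c powr \<sigma> \<le> c" using powr_mono[of \<sigma> 1 c] c \<sigma> by simp
    moreover have "(\<nu> + R) powr \<sigma> \<le> \<nu> powr \<sigma> + R powr \<sigma>"
      using nonneg \<sigma> by (intro powr_add_le_add_powr) auto
    ultimately show ?thesis using c by (intro mult_right_mono mult_mono) auto
  qed
  finally have "Y powr \<sigma> * \<nu> powr (q / 2) * sqrt l
    \<le> c * (\<nu> powr \<sigma> + R powr \<sigma>) * l powr (- \<sigma> / q) * \<nu> powr (q / 2) * sqrt l"
    using nonneg l by (intro mult_right_mono) auto
  also have "\<dots> = c * (\<nu> powr \<sigma> * \<nu> powr (q / 2) + \<nu> powr (q / 2) * R powr \<sigma>) * (l powr (- \<sigma> / q) * l powr (1 / 2))"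
    using l by (simp add: powr_half_sqrt algebra_simps)
  also have "\<nu> powr \<sigma> * \<nu> powr (q / 2) = \<nu>"
    using nonneg by (simp add: powr_add[symmetric] \<sigma>_def)
  also have "l powr (- \<sigma> / q) * l powr (1 / 2) = l powr (1 - 1 / q)"
  proof -
    have "- \<sigma> / q + 1 / 2 = 1 - 1 / q" using q by (simp add: \<sigma>_def field_simps)
    then show ?thesis by (simp add: powr_add[symmetric])
  qed
  finally show ?thesis using \<sigma> by (simp add: \<sigma>_def[symmetric] rpow_def)
qed

text \<open>The factor 2 of \<open>inverse_level_le\<close> divided by min 1 \<xi> / 26, the ratio
  by which \<open>G \<kappa> a\<close> may fall short of D.\<close>

definition level_const :: "real \<Rightarrow> real" where
  "level_const \<xi> = 52 / min 1 \<xi>"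

text \<open>A rounded common bound for both cases of \<open>mu_hat_bound\<close>. The summand 10 (1
  + \<xi>) consists of 4 (1 + \<xi>) from the bias and 6 (1 + \<xi>) from the R D part of the
  spread.\<close>

definition err_const :: "real \<Rightarrow> real \<Rightarrow> real" where
  "err_const K \<xi> = (K * level_const \<xi> + 1) * (40 + 20 * \<xi>) + 10 * (1 + \<xi>)"

section \<open>From the good event to explicit error rates\<close>

context shrinkage_moment
begin

context
  fixes n :: nat and L \<xi> \<epsilon> l D t s \<kappa> R a :: real
  assumes n: "1 \<le> n" and \<xi>: "0 < \<xi>" and \<epsilon>: "0 \<le> \<epsilon>" and L: "0 < L"
    and small: "(1 + 2 * \<xi>) * \<epsilon> + c_bar \<xi> / real n * L \<le> 1"
    and R: "\<bar>\<kappa> - mean P\<bar> \<le> R"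
  defines "l \<equiv> 1 / real n * L" and "D \<equiv> 1 / real n * L + \<epsilon>"
    and "t \<equiv> L + \<xi> * \<epsilon> * real n" and "s \<equiv> L + (2 + \<xi>) * \<epsilon> * real n"
    and "a \<equiv> level ((L + \<xi> * \<epsilon> * real n) / (26 * real n)) \<kappa>"
begin

text \<open>The smallness assumption enters through t \<le> n, which makes the lower level exist,
  and D \<le> 1, which lets powers of D be compared. Comparing l + \<xi> \<epsilon> with D = l +
  \<epsilon> costs the factor min 1 \<xi>.\<close>

lemma small_facts:
  "0 < l" "l \<le> D" "D \<le> 1" "\<epsilon> \<le> D" "0 < D" "t \<le> real n" "0 < t" "0 \<le> R"
  "t / (26 * real n) \<le> (1 + \<xi>) * D" "min 1 \<xi> * D / 26 \<le> t / (26 * real n)" "s \<le> (2 + \<xi>) * D * real n"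
proof -
  have l0: "0 < l" using n L by (simp add: l_def)
  have nl: "real n * l = L" using n by (simp add: l_def)
  have "16 * l \<le> c_bar \<xi> * l"
    using l0 \<xi> by (intro mult_right_mono) (auto simp: c_bar_def)
  then have sm: "\<epsilon> + 2 * (\<xi> * \<epsilon>) + 16 * l \<le> 1"
    using small by (simp add: l_def algebra_simps)
  have xe: "0 \<le> \<xi> * \<epsilon>" using \<xi> \<epsilon> by simp
  have D: "D = l + \<epsilon>" by (simp add: D_def l_def)
  show "0 < l" "l \<le> D" "D \<le> 1" "\<epsilon> \<le> D" "0 < D" "0 \<le> R"
    using l0 \<epsilon> xe sm R by (auto simp: D)
  have t: "t = real n * (l + \<xi> * \<epsilon>)" by (simp add: t_def nl[symmetric] algebra_simps)
  have s: "s = real n * (l + (2 + \<xi>) * \<epsilon>)" by (simp add: s_def nl[symmetric] algebra_simps)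
  have "real n * (l + \<xi> * \<epsilon>) \<le> real n * 1"
    using sm xe \<epsilon> l0 by (intro mult_left_mono) auto
  then show "t \<le> real n" by (simp add: t)
  show "0 < t" using l0 xe n by (simp add: t add_pos_nonneg)
  have tn: "t / (26 * real n) = (l + \<xi> * \<epsilon>) / 26" using n by (simp add: t)
  have "l + \<xi> * \<epsilon> \<le> (1 + \<xi>) * D" using l0 \<epsilon> \<xi> by (simp add: D algebra_simps)
  moreover have "0 \<le> l + \<xi> * \<epsilon>" using l0 xe by simp
  ultimately show "t / (26 * real n) \<le> (1 + \<xi>) * D" unfolding tn by simp
  have "min 1 \<xi> * D \<le> l + \<xi> * \<epsilon>"
  proof -
    have "min 1 \<xi> * l \<le> 1 * l" "min 1 \<xi> * \<epsilon> \<le> \<xi> * \<epsilon>"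
      using l0 \<epsilon> by (intro mult_right_mono; simp)+
    then show ?thesis by (simp add: D distrib_left)
  qed
  then show "min 1 \<xi> * D / 26 \<le> t / (26 * real n)" unfolding tn by simp
  have "l + (2 + \<xi>) * \<epsilon> \<le> (2 + \<xi>) * D" using l0 \<xi> by (simp add: D algebra_simps)
  then show "s \<le> (2 + \<xi>) * D * real n"
    unfolding s using n by (simp add: mult.commute mult_left_mono)
qed

lemma level_bounds: "0 < a" "G \<kappa> a = t / (26 * real n)"
proof -
  have g: "0 < t / (26 * real n)" "t / (26 * real n) < 1"
    using small_facts(6,7) n by (auto simp: field_simps)
  show "0 < a" "G \<kappa> a = t / (26 * real n)"
    using level_pos[OF g, of \<kappa>] G_level[OF g, of \<kappa>] by (auto simp: a_def t_def)
qed

lemma inverse_level_bound: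
  assumes q: "1 < q" "q \<le> p"
  shows "1 / a \<le> level_const \<xi> * (nu P q + R) * D powr (- 1 / q)"
proof -
  define c where "c = min 1 \<xi> / 26"
  have c: "0 < c" "c \<le> 1" using \<xi> by (auto simp: c_def)
  have g: "c * D \<le> G \<kappa> a" using small_facts(10) by (simp add: level_bounds c_def)
  have D: "0 < D" by (rule small_facts)
  have G0: "0 < G \<kappa> a" using g c D by (smt (verit) mult_pos_pos)
  have "1 / a \<le> 2 * (nu P q + R) * G \<kappa> a powr (- 1 / q)"
    by (rule inverse_level_le[OF q R level_bounds(1) G0])
  also have "\<dots> \<le> 2 * (nu P q + R) * ((1 / c) * D powr (- 1 / q))"
  proof (rule mult_left_mono)
    have "G \<kappa> a powr (- 1 / q) \<le> (c * D) powr (- 1 / q)"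
      using g c D q by (intro powr_mono2') auto
    also have "\<dots> = c powr (- 1 / q) * D powr (- 1 / q)"
      using c D by (simp add: powr_mult)
    \<comment> \<open>As c \<le> 1, the exponent -1/q may be lowered to -1, which frees the constant
      from q.\<close>
    also have "\<dots> \<le> c powr (- 1) * D powr (- 1 / q)"
      using c q by (intro mult_right_mono powr_mono') auto
    finally show "G \<kappa> a powr (- 1 / q) \<le> (1 / c) * D powr (- 1 / q)"
      using c by (simp add: powr_minus field_simps)
  qed (use nu_nonneg[of q] small_facts(8) in simp)
  also have "\<dots> = level_const \<xi> * (nu P q + R) * D powr (- 1 / q)"
    by (simp add: level_const_def c_def)
  finally show ?thesis .
qed

lemma inverse_level_mult_bound:
  assumes q: "1 < q" "q \<le> p"
  shows "D / a \<le> level_const \<xi> * ((nu P q + R) * D powr (1 - 1 / q))"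
proof -
  have D: "0 < D" by (rule small_facts)
  have "D / a = D * (1 / a)" by simp
  also have "\<dots> \<le> D * (level_const \<xi> * (nu P q + R) * D powr (- 1 / q))"
    using D by (intro mult_left_mono inverse_level_bound q) auto
  also have "\<dots> = level_const \<xi> * ((nu P q + R) * (D powr 1 * D powr (- 1 / q)))"
    using D by simp
  also have "D powr 1 * D powr (- 1 / q) = D powr (1 - 1 / q)"
    unfolding powr_add[symmetric] by simp
  finally show ?thesis .
qed

lemma R_mult_bound:
  assumes q: "1 < q" "q \<le> p"
  shows "R * D \<le> (nu P q + R) * D powr (1 - 1 / q)"
proof (rule mult_mono)
  have "D powr 1 \<le> D powr (1 - 1 / q)" using small_facts q by (intro powr_mono') auto
  then show "D \<le> D powr (1 - 1 / q)" using small_facts(5) by simp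
qed (use nu_nonneg[of q] small_facts in auto)

lemma bias_bound:
  assumes q: "1 < q" "q \<le> p"
  shows "bias \<kappa> a \<le> 4 * (1 + \<xi>) * ((nu P q + R) * D powr (1 - 1 / q))"
proof -
  have G0: "0 < G \<kappa> a" unfolding level_bounds using small_facts n by simp
  have D: "0 < D" by (rule small_facts)
  have "bias \<kappa> a \<le> 4 * (nu P q + R) * G \<kappa> a powr (1 - 1 / q)"
    by (rule bias_le[OF q R level_bounds(1) G0])
  also have "\<dots> \<le> 4 * (nu P q + R) * ((1 + \<xi>) * D powr (1 - 1 / q))"
  proof (rule mult_left_mono)
    have "G \<kappa> a powr (1 - 1 / q) \<le> ((1 + \<xi>) * D) powr (1 - 1 / q)"
      using G0 small_facts(9) q by (intro powr_mono2) (auto simp: level_bounds)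
    also have "\<dots> = (1 + \<xi>) powr (1 - 1 / q) * D powr (1 - 1 / q)"
      using \<xi> D by (simp add: powr_mult)
    also have "\<dots> \<le> (1 + \<xi>) powr 1 * D powr (1 - 1 / q)"
      using \<xi> q by (intro mult_right_mono powr_mono) auto
    finally show "G \<kappa> a powr (1 - 1 / q) \<le> (1 + \<xi>) * D powr (1 - 1 / q)" using \<xi> by simp
  qed (use nu_nonneg[of q] small_facts(8) in simp)
  finally show ?thesis by (simp add: algebra_simps)
qed

lemma spread_bound:
  assumes q: "1 < q" "q \<le> min 2 p"
  shows "sqrt (spread \<kappa> a * l) \<le> 2 * (K * level_const \<xi> + 1) *
      ((nu P q + nu P q powr (q / 2) * rpow R (1 - q / 2)) * l powr (1 - 1 / q)) + 2 * (1 + \<xi>) * (R * D)"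
proof -
  have qp: "1 < q" "q \<le> p" "q \<le> 2" using q by auto
  have G0: "0 < G \<kappa> a" unfolding level_bounds using small_facts n by simp
  have l: "0 < l" "l \<le> D" and D: "0 < D" "D \<le> 1" and R0: "0 \<le> R" by (rule small_facts)+
  have a: "0 < a" by (rule level_bounds)
  define Y where "Y = K / a + R"
  define U where "U = Y powr (1 - q / 2) * nu P q powr (q / 2) * sqrt l"
  define V where "V = (1 + \<xi>) * (R * D)"
  have lc: "0 < level_const \<xi>" using \<xi> by (simp add: level_const_def)
  have Y0: "0 < Y" using K_ge_1 a R0 by (auto simp: Y_def intro!: add_pos_nonneg)
  have V0: "0 \<le> V" using \<xi> R0 D by (simp add: V_def)
  have U0: "0 \<le> U" using l by (simp add: U_def)
  have "spread \<kappa> a * l \<le> (2 * (Y powr (2 - q) * nu P q powr q) + 2 * (R\<^sup>2 * G \<kappa> a)) * l"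
    unfolding Y_def using l by (intro mult_right_mono spread_le[OF qp(1,2) R a G0 qp(3)]) auto
  also have "\<dots> = 2 * (Y powr (2 - q) * nu P q powr q * l) + 2 * (R\<^sup>2 * (G \<kappa> a * l))"
    by (simp add: algebra_simps)
  also have "Y powr (2 - q) * nu P q powr q * l = U\<^sup>2"
  proof -
    have "(Y powr (1 - q / 2))\<^sup>2 = Y powr (2 - q)" "(nu P q powr (q / 2))\<^sup>2 = nu P q powr q"
      using Y0 by (simp_all add: power2_eq_square powr_add[symmetric])
    then show ?thesis using l by (simp add: U_def power_mult_distrib)
  qed
  \<comment> \<open>Both \<open>G \<kappa> a\<close> and \<open>l\<close> are at most (1 + \<xi>) D,
    so this part becomes a perfect square and its root is only a multiple of R D, absorbed by the
    second infimum.\<close>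
  also have "R\<^sup>2 * (G \<kappa> a * l) \<le> R\<^sup>2 * (((1 + \<xi>) * D) * ((1 + \<xi>) * D))"
  proof (intro mult_left_mono mult_mono)
    show "G \<kappa> a \<le> (1 + \<xi>) * D" unfolding level_bounds by (rule small_facts)
    have "1 * D \<le> (1 + \<xi>) * D" using \<xi> D by (intro mult_right_mono) auto
    then show "l \<le> (1 + \<xi>) * D" using l by linarith
  qed (use \<xi> D l in auto)
  also have "\<dots> = V\<^sup>2" by (simp add: V_def power2_eq_square)
  finally have "spread \<kappa> a * l \<le> 2 * U\<^sup>2 + 2 * V\<^sup>2" by simp
  also have "\<dots> \<le> (2 * U + 2 * V)\<^sup>2"
    using U0 V0 by (simp add: power2_eq_square algebra_simps add_increasing)
  finally have "sqrt (spread \<kappa> a * l) \<le> 2 * U + 2 * V"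
    using U0 V0 by (intro real_le_lsqrt) auto
  also have "U \<le> (K * level_const \<xi> + 1) * (nu P q + nu P q powr (q / 2) * rpow R (1 - q / 2)) * l powr (1 - 1 / q)"
    unfolding U_def
  proof (rule interpolation_bound)
    have Dl: "D powr (- 1 / q) \<le> l powr (- 1 / q)" using l q by (intro powr_mono2') auto
    have "K / a = K * (1 / a)" by simp
    also have "\<dots> \<le> K * (level_const \<xi> * (nu P q + R) * D powr (- 1 / q))"
      using K_ge_1 by (intro mult_left_mono inverse_level_bound qp) auto
    also have "\<dots> \<le> K * (level_const \<xi> * (nu P q + R) * l powr (- 1 / q))"
      using K_ge_1 lc nu_nonneg[of q] R0 by (intro mult_left_mono Dl mult_nonneg_nonneg) auto
    finally have Ka: "K / a \<le> K * (level_const \<xi> * (nu P q + R) * l powr (- 1 / q))" .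
    \<comment> \<open>Since l \<le> 1, its negative power is at least 1, so the summand
      \<open>R\<close> of \<open>Y\<close> fits the same shape as K / a.\<close>
    have "l powr 0 \<le> l powr (- 1 / q)" using l D q by (intro powr_mono') auto
    then have "R * 1 \<le> (nu P q + R) * l powr (- 1 / q)"
      using nu_nonneg[of q] R0 l by (intro mult_mono) auto
    then show "Y \<le> (K * level_const \<xi> + 1) * (nu P q + R) * l powr (- 1 / q)"
      using Ka by (simp add: Y_def algebra_simps)
  qed (use nu_nonneg[of q] R0 K_ge_1 lc l qp Y0 in auto)
  finally show ?thesis by (simp add: V_def algebra_simps)
qed

text \<open>\<open>q\<close> and \<open>q'\<close> are independent because \<open>q\<close> serves
  only the spread, while bias, contamination and R D are charged to \<open>q'\<close>. Neither
  affects the hypothesis \<open>good\<close>.\<close>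

lemma mu_hat_bound:
  assumes good: "good_sample n L t s \<kappa> x" and y: "y \<in> contaminated n \<epsilon> x"
    and q: "q \<in> {1<..min 2 p}" and q': "q' \<in> {1<..p}"
  shows "\<bar>mu_hat w (L + (1 + \<xi>) * \<epsilon> * real n) n \<kappa> y - mean P\<bar> \<le> err_const K \<xi> *
    ((nu P q + nu P q powr (q / 2) * rpow R (1 - q / 2)) * l powr (1 - 1 / q)
      + (nu P q' + R) * D powr (1 - 1 / q'))"
proof -
  define \<eta> where "\<eta> = L + (1 + \<xi>) * \<epsilon> * real n"
  define A where "A = (nu P q + nu P q powr (q / 2) * rpow R (1 - q / 2)) * l powr (1 - 1 / q)"
  define B where "B = (nu P q' + R) * D powr (1 - 1 / q')"
  define k where "k = K * level_const \<xi>"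
  note facts = small_facts
  have qs: "1 < q" "q \<le> min 2 p" "1 < q'" "q' \<le> p" using q q' by auto
  have a: "0 < a" by (rule level_bounds)
  have n0: "0 < real n" using n by simp
  have A0: "0 \<le> A" unfolding A_def
    using nu_nonneg[of q] by (intro mult_nonneg_nonneg add_nonneg_nonneg) (auto simp: rpow_def)
  have B0: "0 \<le> B" unfolding B_def using nu_nonneg[of q'] facts(8) by simp
  have k0: "0 \<le> k" using K_ge_1 \<xi> by (simp add: k_def level_const_def)
  have Ka0: "0 \<le> K / a" using K_ge_1 a by simp
  have KaD: "K / a * D \<le> k * B"
    using mult_left_mono[OF inverse_level_mult_bound[OF qs(3,4)], of K] K_ge_1
    by (simp add: k_def B_def)
  have RD: "R * D \<le> B" unfolding B_def by (rule R_mult_bound[OF qs(3,4)])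
  have good1: "(\<Sum>i<n. 1 - w (a * \<bar>x i - \<kappa>\<bar>)) < t"
    and good2: "\<bar>\<Sum>i<n. residual \<kappa> a (x i)\<bar> < deviation n L \<kappa> a"
    using good unfolding good_sample_def a_def t_def by auto
  have "t + \<epsilon> * real n = \<eta>" by (simp add: t_def \<eta>_def algebra_simps)
  then have ge: "ereal a \<le> alpha_hat w \<eta> n \<kappa> y"
    using good1 by (intro alpha_hat_ge[OF y a]) linarith
  have "\<bar>mu_hat w \<eta> n \<kappa> y - mean P\<bar> \<le> err_const K \<xi> * (A + B)"
  proof (cases "6 * s < real n")
    case True
    define b where "b = level (6 * s / real n) \<kappa>"
    have s0: "0 < s" using L \<xi> \<epsilon> by (auto simp: s_def intro!: add_pos_nonneg)
    have gs: "0 < 6 * s / real n" "6 * s / real n < 1" using True s0 n0 by (auto simp: field_simps)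
    have b: "0 < b" using level_pos[OF gs] by (simp add: b_def)
    have good3: "s < (\<Sum>i<n. 1 - w (b * \<bar>x i - \<kappa>\<bar>))" "(\<Sum>i<n. 1 - w (b * \<bar>x i - \<kappa>\<bar>)) < 14 * s"
      using good True unfolding good_sample_def b_def by auto
    have "\<eta> + \<epsilon> * real n = s" by (simp add: s_def \<eta>_def algebra_simps)
    then have le: "alpha_hat w \<eta> n \<kappa> y \<le> ereal b"
      using good3(1) by (intro alpha_hat_le[OF y b]) linarith
    define d where "d = deviation n L \<kappa> a / real n"
    have "\<bar>mu_hat w \<eta> n \<kappa> y - mean P\<bar> \<le> d + K / a * (2 * \<epsilon> + 14 * s / real n)"
    proof (rule mu_hat_error_le[OF n y a ge le])
      show "\<bar>\<Sum>i<n. (x i - \<kappa>) * w (a * \<bar>x i - \<kappa>\<bar>) - (mean P - \<kappa>)\<bar> \<le> real n * d"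
        using good2 n0 by (simp add: d_def residual_def)
      show "(\<Sum>i<n. 1 - w (b * \<bar>x i - \<kappa>\<bar>)) \<le> real n * (14 * s / real n)"
        using good3(2) n0 by simp
    qed
    also have "d \<le> bias \<kappa> a + (3 * (l * (K / a + R)) + 3 * sqrt (spread \<kappa> a * l))"
    proof -
      have V0: "0 \<le> spread \<kappa> a" by (simp add: spread_def integral_nonneg_AE)
      have l: "L = real n * l" using n by (simp add: l_def)
      have l0: "0 < l" by (rule facts)
      let ?u = "K / a + \<bar>\<kappa> - mean P\<bar>" and ?v = "sqrt (spread \<kappa> a / l)"
      have "d = bias \<kappa> a + 3 * (l * max ?u ?v)"
        using n0 by (simp add: d_def deviation_def l add_divide_distrib)
      also have "l * max ?u ?v \<le> l * (K / a + R) + l * ?v"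
      proof -
        have "max ?u ?v \<le> (K / a + R) + ?v"
          using R Ka0 V0 l0 by (auto simp: max_def intro: add_increasing2)
        from mult_left_mono[OF this, of l] show ?thesis using l0 by (simp add: distrib_left)
      qed
      also have "l * ?v = sqrt (spread \<kappa> a * l)"
      proof -
        have "l * ?v = sqrt (l\<^sup>2) * ?v" using l0 by simp
        also have "\<dots> = sqrt (l\<^sup>2 * (spread \<kappa> a / l))" by (rule real_sqrt_mult[symmetric])
        also have "l\<^sup>2 * (spread \<kappa> a / l) = spread \<kappa> a * l" using l0 by (simp add: power2_eq_square)
        finally show ?thesis .
      qed
      finally show ?thesis by simp
    qed
    also have "bias \<kappa> a \<le> 4 * (1 + \<xi>) * B"
      unfolding B_def by (rule bias_bound[OF qs(3,4)])
    also have "l * (K / a + R) \<le> (k + 1) * B"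
    proof -
      have "l * (K / a + R) \<le> D * (K / a + R)"
        using facts Ka0 by (intro mult_right_mono) auto
      then show ?thesis using KaD RD by (simp add: algebra_simps)
    qed
    also have "sqrt (spread \<kappa> a * l) \<le> 2 * (k + 1) * A + 2 * (1 + \<xi>) * B"
    proof -
      have "2 * (1 + \<xi>) * (R * D) \<le> 2 * (1 + \<xi>) * B" using RD \<xi> by (intro mult_left_mono) auto
      then show ?thesis using spread_bound[OF qs(1,2)] by (simp add: A_def k_def)
    qed
    also have "K / a * (2 * \<epsilon> + 14 * s / real n) \<le> (30 + 14 * \<xi>) * (k * B)"
    proof -
      have "s / real n \<le> (2 + \<xi>) * D" using facts(11) n0 by (simp add: field_simps)
      then have "2 * \<epsilon> + 14 * (s / real n) \<le> 2 * D + 14 * ((2 + \<xi>) * D)"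
        using facts(4) by (intro add_mono mult_left_mono) auto
      then have "2 * \<epsilon> + 14 * s / real n \<le> (30 + 14 * \<xi>) * D"
        by (simp add: algebra_simps)
      then have "K / a * (2 * \<epsilon> + 14 * s / real n) \<le> K / a * ((30 + 14 * \<xi>) * D)"
        by (rule mult_left_mono) (rule Ka0)
      also have "\<dots> = (30 + 14 * \<xi>) * (K / a * D)" by simp
      also have "\<dots> \<le> (30 + 14 * \<xi>) * (k * B)" using KaD \<xi> by (intro mult_left_mono) auto
      finally show ?thesis .
    qed
    finally have "\<bar>mu_hat w \<eta> n \<kappa> y - mean P\<bar> \<le>
      4 * (1 + \<xi>) * B + (3 * ((k + 1) * B) + 3 * (2 * (k + 1) * A + 2 * (1 + \<xi>) * B)) + (30 + 14 * \<xi>) * (k * B)"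
      by simp
    also have "\<dots> \<le> ((k + 1) * (40 + 20 * \<xi>) + 10 * (1 + \<xi>)) * (A + B)"
    proof -
      have "0 \<le> k * A" "0 \<le> k * B" "0 \<le> \<xi> * A" "0 \<le> \<xi> * B" "0 \<le> \<xi> * (k * A)" "0 \<le> \<xi> * (k * B)"
        using k0 \<xi> A0 B0 by auto
      then show ?thesis using A0 B0 by (simp add: algebra_simps)
    qed
    finally show ?thesis by (simp add: err_const_def k_def)
  next
    case False
    define c where "c = 6 * (2 + \<xi>)"
    have c0: "0 \<le> c" using \<xi> by (simp add: c_def)
    \<comment> \<open>Failure of 6 s < n means that D is bounded below by 1 / c, so multiplying the
      trivial bound by c D restores the rate.\<close>
    have "c * D * real n = 6 * ((2 + \<xi>) * D * real n)" by (simp add: c_def)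
    then have "real n \<le> c * D * real n" using False facts(11) by linarith
    then have cD: "1 \<le> c * D" using n0 by simp
    have "\<bar>mu_hat w \<eta> n \<kappa> y - mean P\<bar> \<le> K / a + R"
      using mu_hat_diff_base_le[OF n a ge] R by linarith
    also have "\<dots> \<le> (c * D) * (K / a + R)"
      using mult_right_mono[OF cD, of "K / a + R"] Ka0 facts(8) by simp
    also have "\<dots> = c * (K / a * D + R * D)" by (simp add: algebra_simps)
    also have "\<dots> \<le> c * (k * B + B)" using KaD RD c0 by (intro mult_left_mono add_mono)
    also have "\<dots> \<le> ((k + 1) * (40 + 20 * \<xi>) + 10 * (1 + \<xi>)) * (A + B)"
    proof -
      have "0 \<le> k * A" "0 \<le> k * B" "0 \<le> \<xi> * A" "0 \<le> \<xi> * B" "0 \<le> \<xi> * (k * A)" "0 \<le> \<xi> * (k * B)"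
        using k0 \<xi> A0 B0 by auto
      then show ?thesis using A0 B0 by (simp add: c_def algebra_simps)
    qed
    finally show ?thesis by (simp add: err_const_def k_def)
  qed
  then show ?thesis by (simp add: A_def B_def \<eta>_def)
qed

end

end

section \<open>The quantile bound\<close>

lemma err_const_pos:
  assumes "1 \<le> K" "0 < \<xi>"
  shows "0 < err_const K \<xi>"
  unfolding err_const_def level_const_def using assms
  by (intro add_nonneg_pos mult_nonneg_nonneg add_nonneg_nonneg mult_pos_pos) auto

lemma err_bound_term_nonneg:
  shows "0 \<le> (nu P q + nu P q powr (q / 2) * rpow R (1 - q / 2)) * x powr y"
    and "0 \<le> R \<Longrightarrow> 0 \<le> (nu P q + R) * x powr y"
  by (auto simp: nu_def rpow_def intro!: mult_nonneg_nonneg add_nonneg_nonneg)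

lemma err_bound_nonneg:
  assumes "1 < p" "0 \<le> R"
  shows "0 \<le> err_bound P p R \<epsilon> n \<delta>"
  unfolding err_bound_def using assms
  by (intro add_nonneg_nonneg cINF_greatest err_bound_term_nonneg) auto

text \<open>The two infima range over independent variables, so they can be taken one after the
  other: first over \<open>q\<close> with \<open>q'\<close> fixed, then over
  \<open>q'\<close>.\<close>

lemma le_err_bound:
  assumes p: "1 < p" and C: "0 < C"
    and le: "\<And>q q'. q \<in> {1<..min 2 p} \<Longrightarrow> q' \<in> {1<..p} \<Longrightarrow> v \<le> C *
      ((nu P q + nu P q powr (q / 2) * rpow R (1 - q / 2)) * (1 / real n * ln (4 / \<delta>)) powr (1 - 1 / q)
        + (nu P q' + R) * (1 / real n * ln (4 / \<delta>) + \<epsilon>) powr (1 - 1 / q'))"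
  shows "v \<le> C * err_bound P p R \<epsilon> n \<delta>"
proof -
  define A where "A = (\<lambda>q. (nu P q + nu P q powr (q / 2) * rpow R (1 - q / 2)) * (1 / real n * ln (4 / \<delta>)) powr (1 - 1 / q))"
  define B where "B = (\<lambda>q. (nu P q + R) * (1 / real n * ln (4 / \<delta>) + \<epsilon>) powr (1 - 1 / q))"
  have v: "v / C \<le> A q + B q'" if "q \<in> {1<..min 2 p}" "q' \<in> {1<..p}" for q q'
    using le[OF that] C by (simp add: A_def B_def field_simps)
  have "v / C - B q' \<le> (INF q\<in>{1<..min 2 p}. A q)" if "q' \<in> {1<..p}" for q'
    using p v[OF _ that] by (intro cINF_greatest) (auto simp: algebra_simps)
  then have "v / C - (INF q\<in>{1<..min 2 p}. A q) \<le> (INF q\<in>{1<..p}. B q)"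
    using p by (intro cINF_greatest) (auto simp: algebra_simps)
  then have "v / C \<le> err_bound P p R \<epsilon> n \<delta>"
    by (simp add: err_bound_def A_def B_def)
  then show ?thesis using C by (simp add: field_simps)
qed

lemma interpolated_nu_le:
  assumes "0 \<le> \<nu>" "0 \<le> R" "R \<le> C * \<nu>" "0 < C" "1 < q" "q \<le> 2"
  shows "\<nu> + \<nu> powr (q / 2) * rpow R (1 - q / 2) \<le> (2 + C) * \<nu>"
proof (cases "q = 2")
  case True
  then show ?thesis using assms by (simp add: rpow_def algebra_simps)
next
  case False
  define \<sigma> where "\<sigma> = 1 - q / 2"
  have \<sigma>: "0 < \<sigma>" "\<sigma> \<le> 1" using False assms by (auto simp: \<sigma>_def)
  have "R powr \<sigma> \<le> (C * \<nu>) powr \<sigma>" using assms \<sigma> by (intro powr_mono2) auto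
  also have "\<dots> = C powr \<sigma> * \<nu> powr \<sigma>" using assms by (simp add: powr_mult)
  also have "\<dots> \<le> (1 + C) * \<nu> powr \<sigma>"
  proof (rule mult_right_mono)
    \<comment> \<open>Passing through 1 + C covers C < 1 and C \<ge> 1 at once.\<close>
    have "C powr \<sigma> \<le> (1 + C) powr \<sigma>" using assms \<sigma> by (intro powr_mono2) auto
    also have "\<dots> \<le> (1 + C) powr 1" using assms \<sigma> by (intro powr_mono) auto
    finally show "C powr \<sigma> \<le> 1 + C" using assms by simp
  qed simp
  finally have "\<nu> powr (q / 2) * R powr \<sigma> \<le> \<nu> powr (q / 2) * ((1 + C) * \<nu> powr \<sigma>)"
    by (intro mult_left_mono) auto
  also have "\<dots> = (1 + C) * (\<nu> powr (q / 2) * \<nu> powr \<sigma>)" by simp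
  also have "\<nu> powr (q / 2) * \<nu> powr \<sigma> = \<nu>"
    using assms by (simp add: powr_add[symmetric] \<sigma>_def)
  finally show ?thesis using \<sigma> by (simp add: rpow_def \<sigma>_def[symmetric] algebra_simps)
qed

lemma double_powr_le:
  fixes x :: real
  assumes "0 \<le> x" "x \<le> 2 * y" "0 \<le> y" "1 \<le> q"
  shows "x powr (1 - 1 / q) \<le> 2 * y powr (1 - 1 / q)"
proof -
  have "x powr (1 - 1 / q) \<le> (2 * y) powr (1 - 1 / q)"
    using assms by (intro powr_mono2) auto
  also have "\<dots> = 2 powr (1 - 1 / q) * y powr (1 - 1 / q)"
    using assms by (simp add: powr_mult)
  also have "\<dots> \<le> 2 powr 1 * y powr (1 - 1 / q)"
    using assms by (intro mult_right_mono powr_mono) auto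
  finally show ?thesis by simp
qed

text \<open>Bridges the sample as a function on all naturals and its restriction to indices below
  \<open>n\<close>, an element of the product space.\<close>

lemma good_sample_cong:
  assumes "shrinkage w K P" "\<And>i. i < n \<Longrightarrow> x i = y i"
  shows "shrinkage.good_sample w K P n L t s \<kappa> x \<longleftrightarrow> shrinkage.good_sample w K P n L t s \<kappa> y"
proof -
  have "(\<Sum>i<n. f (x i)) = (\<Sum>i<n. f (y i))" for f :: "real \<Rightarrow> real"
    using assms(2) by (intro sum.cong) auto
  note eq = this[of "\<lambda>u. 1 - w (c * \<bar>u - \<kappa>\<bar>)" for c] this
  show ?thesis
    unfolding shrinkage.good_sample_def[OF assms(1)] eq ..
qed

text \<open>The bound is stated for all pairs \<open>q\<close>, \<open>q'\<close> on one event, so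
  that infima can be formed or particular orders picked afterwards. The smallness condition allows
  equality because the smallest admissible \<delta> in the second part of the theorem may attain
  it.\<close>

lemma (in shrinkage_moment) prob_mu_hat_bound:
  assumes M: "prob_space M" and iid: "iid_sample M P n X" and ind: "indep_of_sample M n \<kappa> X"
    and n: "1 \<le> n" and \<xi>: "0 < \<xi>" and \<epsilon>: "0 \<le> \<epsilon>" and \<delta>: "0 < \<delta>" "\<delta> < 1"
    and small: "(1 + 2 * \<xi>) * \<epsilon> + c_bar \<xi> / real n * ln (4 / \<delta>) \<le> 1"
  defines "R \<equiv> err_quantile M \<kappa> (mean P) (\<delta> / 4)"
  shows "prob_at_least M (1 - \<delta>) (\<lambda>\<omega>. \<forall>Y\<in>contaminated n \<epsilon> (\<lambda>i. X i \<omega>). \<forall>q\<in>{1<..min 2 p}. \<forall>q'\<in>{1<..p}.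
    \<bar>mu_hat w (ln (4 / \<delta>) + (1 + \<xi>) * \<epsilon> * real n) n (\<kappa> \<omega>) Y - mean P\<bar> \<le> err_const K \<xi> *
      ((nu P q + nu P q powr (q / 2) * rpow R (1 - q / 2)) * (1 / real n * ln (4 / \<delta>)) powr (1 - 1 / q)
        + (nu P q' + R) * (1 / real n * ln (4 / \<delta>) + \<epsilon>) powr (1 - 1 / q')))"
proof -
  interpret M: prob_space M by fact
  define L where "L = ln (4 / \<delta>)"
  define t where "t = L + \<xi> * \<epsilon> * real n"
  define s where "s = L + (2 + \<xi>) * \<epsilon> * real n"
  have L: "0 < L" using \<delta> by (simp add: L_def)
  have small': "(1 + 2 * \<xi>) * \<epsilon> + c_bar \<xi> / real n * L \<le> 1" using small by (simp add: L_def)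
  have ts: "L \<le> t" "L \<le> s" using \<xi> \<epsilon> by (auto simp: t_def s_def)
  \<comment> \<open>This fact does not involve the base estimate, so the context is instantiated
    with centre \<open>mean P\<close> and R = 0.\<close>
  have tn: "t \<le> real n"
    unfolding t_def by (rule small_facts(6)[OF n \<xi> \<epsilon> L small', of "mean P" 0]) simp
  have k[measurable]: "\<kappa> \<in> borel_measurable M" using ind by (simp add: indep_of_sample_def)
  let ?Q = "PiM {..<n} (\<lambda>_. P)"
  define S where "S = {z \<in> space (borel \<Otimes>\<^sub>M ?Q). \<not> good_sample n L t s (fst z) (snd z)}"
  define B1 where "B1 = {\<omega> \<in> space M. \<bar>\<kappa> \<omega> - mean P\<bar> > R}"
  define B2 where "B2 = {\<omega> \<in> space M. (\<kappa> \<omega>, \<lambda>i\<in>{..<n}. X i \<omega>) \<in> S}"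
  have S: "S \<in> sets (borel \<Otimes>\<^sub>M ?Q)"
    unfolding S_def by (rule measurable_not_good_sample[OF L ts tn])
  have sec: "measure ?Q {x \<in> space ?Q. (k, x) \<in> S} \<le> 5 * exp (- 2 * L)" for k
    using prob_not_good_sample[OF L ts tn, of k] by (simp add: S_def space_pair_measure cong: conj_cong)
  have B2: "B2 \<in> sets M" "measure M B2 \<le> 5 * exp (- 2 * L)"
    unfolding B2_def using indep_of_sample_measure_le[OF M iid ind n S sec] by auto
  have B1: "B1 \<in> sets M" "measure M B1 \<le> \<delta> / 4" "0 \<le> R"
    using err_quantile_nonneg_tail[OF M k, of "\<delta> / 4" "mean P"] \<delta> unfolding B1_def R_def by auto
  \<comment> \<open>The five tails sum to 5 \<delta>^2 / 16, within the budget 3 \<delta> / 4; the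
    remaining \<delta> / 4 pays for the base estimate exceeding its quantile.\<close>
  have "exp (- 2 * L) = exp (- L) * exp (- L)" by (simp add: exp_add[symmetric])
  also have "exp (- L) = \<delta> / 4" using \<delta> by (simp add: L_def exp_minus)
  finally have e: "exp (- 2 * L) = \<delta> * \<delta> / 16" by simp
  have "\<delta> * \<delta> \<le> \<delta>" using \<delta> by (simp add: mult_left_le)
  then have le: "5 * exp (- 2 * L) \<le> 3 / 4 * \<delta>" using e \<delta> by linarith
  have "measure M (B1 \<union> B2) \<le> measure M B1 + measure M B2"
    using B1 B2 by (intro measure_Un_le) auto
  then have "1 - \<delta> \<le> measure M (space M - (B1 \<union> B2))"
    using B1 B2 le by (subst M.prob_compl) auto
  moreover have "space M - (B1 \<union> B2) \<in> sets M" using B1 B2 by auto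
  moreover have "\<bar>mu_hat w (L + (1 + \<xi>) * \<epsilon> * real n) n (\<kappa> \<omega>) Y - mean P\<bar> \<le> err_const K \<xi> *
      ((nu P q + nu P q powr (q / 2) * rpow R (1 - q / 2)) * (1 / real n * L) powr (1 - 1 / q)
        + (nu P q' + R) * (1 / real n * L + \<epsilon>) powr (1 - 1 / q'))"
    if \<omega>: "\<omega> \<in> space M - (B1 \<union> B2)" and Y: "Y \<in> contaminated n \<epsilon> (\<lambda>i. X i \<omega>)"
      and q: "q \<in> {1<..min 2 p}" and q': "q' \<in> {1<..p}" for \<omega> Y q q'
  proof (rule mu_hat_bound[OF n \<xi> \<epsilon> L small' _ _ Y q q'])
    show "\<bar>\<kappa> \<omega> - mean P\<bar> \<le> R" using \<omega> by (auto simp: B1_def)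
    have "(\<lambda>i\<in>{..<n}. X i \<omega>) \<in> space ?Q" by (auto simp: space_PiM)
    then have "good_sample n L t s (\<kappa> \<omega>) (\<lambda>i\<in>{..<n}. X i \<omega>)"
      using \<omega> by (auto simp: B2_def S_def space_pair_measure)
    then show "good_sample n L (L + \<xi> * \<epsilon> * real n) (L + (2 + \<xi>) * \<epsilon> * real n) (\<kappa> \<omega>) (\<lambda>i. X i \<omega>)"
      using good_sample_cong[OF shrinkage_axioms, of n "\<lambda>i\<in>{..<n}. X i \<omega>" "\<lambda>i. X i \<omega>"]
      by (simp add: t_def s_def)
  qed
  ultimately show ?thesis
    unfolding prob_at_least_def L_def by (intro bexI[of _ "space M - (B1 \<union> B2)"]) auto
qed

theorem theorem3p1:
  fixes w :: "real \<Rightarrow> real" and \<xi> :: real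
  assumes "weight_fun w"
    and "bdd_above ((\<lambda>t. t * w t) ` {0..})"
    and "\<xi> > 0"
  shows "\<exists>Cw>0. \<forall>(p::real) (\<P>::real measure set) (n::nat)
           (M::real measure \<Rightarrow> 'a measure) (X::nat \<Rightarrow> 'a \<Rightarrow> real) (\<kappa>::'a \<Rightarrow> real).
      p > 1 \<longrightarrow>
      (\<forall>t\<ge>0. w t \<ge> max (1 - t powr p) 0) \<longrightarrow>
      n \<ge> 1 \<longrightarrow>
      (\<forall>P\<in>\<P>. atom_free_moment p P) \<longrightarrow>
      (\<forall>P\<in>\<P>. prob_space (M P) \<and> iid_sample (M P) P n X \<and> indep_of_sample (M P) n \<kappa> X) \<longrightarrow>
      (\<forall>P\<in>\<P>. \<forall>\<epsilon> \<delta>. 0 \<le> \<epsilon> \<longrightarrow> \<epsilon> < 1 / 2 \<longrightarrow> 0 < \<delta> \<longrightarrow> \<delta> < 1 \<longrightarrow>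
         (1 + 2 * \<xi>) * \<epsilon> + c_bar \<xi> / real n * ln (4 / \<delta>) < 1 \<longrightarrow>
         prob_at_least (M P) (1 - \<delta>)
           (\<lambda>\<omega>. \<forall>Y\<in>contaminated n \<epsilon> (\<lambda>i. X i \<omega>).
              \<bar>mu_hat w (ln (4 / \<delta>) + (1 + \<xi>) * \<epsilon> * real n) n (\<kappa> \<omega>) Y - mean P\<bar>
                \<le> Cw * err_bound P p (err_quantile (M P) \<kappa> (mean P) (\<delta> / 4)) \<epsilon> n \<delta>)) \<and>
      (\<forall>C \<delta>min. C > 0 \<longrightarrow> \<delta>min > 0 \<longrightarrow>
         (\<forall>q\<in>{min 2 p..p}. \<forall>\<delta>. \<delta>min \<le> \<delta> \<longrightarrow> \<delta> < 1 \<longrightarrow>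
            (\<forall>P\<in>\<P>. err_quantile (M P) \<kappa> (mean P) (\<delta> / 4) \<le> C * nu P q)) \<longrightarrow>
         (\<forall>P\<in>\<P>. \<forall>\<epsilon> \<delta>. 0 \<le> \<epsilon> \<longrightarrow> \<epsilon> < 1 / 2 \<longrightarrow> 0 < \<delta> \<longrightarrow> \<delta> < 1 \<longrightarrow>
            \<delta> \<ge> max \<delta>min (4 * exp (- ((1 - (1 + 2 * \<xi>) * \<epsilon>) / c_bar \<xi> * real n))) \<longrightarrow>
            prob_at_most (M P) \<delta>
              (\<lambda>\<omega>. (SUP Y\<in>contaminated n \<epsilon> (\<lambda>i. X i \<omega>).
                  ereal \<bar>mu_hat w (ln (4 / \<delta>) + (1 + \<xi>) * \<epsilon> * real n) n (\<kappa> \<omega>) Y - mean P\<bar>)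
                > ereal (Cw * (2 * C + 3) *
                    (nu P (min 2 p) * (1 / real n * ln (4 / \<delta>)) powr (1 - 1 / min 2 p)
                     + nu P p * \<epsilon> powr (1 - 1 / p))))))"
proof -
  obtain K0 where K0: "\<And>t. 0 \<le> t \<Longrightarrow> t * w t \<le> K0"
    using assms(2) by (auto simp: bdd_above_def)
  define K where "K = max 1 K0"
  have K: "1 \<le> K" "\<And>t. 0 \<le> t \<Longrightarrow> t * w t \<le> K"
    using K0 by (auto simp: K_def intro: max.coboundedI2)
  define C0 where "C0 = err_const K \<xi>"
  have C0: "0 < C0" unfolding C0_def by (rule err_const_pos) (use K assms in auto)
  show ?thesis
  \<comment> \<open>The factor 2 is needed for the second part only, to split powers of \<open>l + \<epsilon>\<close>.\<close>
  proof (intro exI[of _ "2 * C0"] conjI allI impI ballI)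
    show "0 < 2 * C0" using C0 by simp
  next
    fix p :: real and \<P> :: "real measure set" and n :: nat and M :: "real measure \<Rightarrow> 'a measure"
      and X :: "nat \<Rightarrow> 'a \<Rightarrow> real" and \<kappa> :: "'a \<Rightarrow> real"
    assume p: "1 < p" and w: "\<forall>t\<ge>0. max (1 - t powr p) 0 \<le> w t" and n: "1 \<le> n"
      and af: "\<forall>P\<in>\<P>. atom_free_moment p P"
      and MX: "\<forall>P\<in>\<P>. prob_space (M P) \<and> iid_sample (M P) P n X \<and> indep_of_sample (M P) n \<kappa> X"
    have loc: "shrinkage_moment w K P p" if "P \<in> \<P>" for P
    proof -
      have a: "prob_space P" "sets P = sets borel" "\<And>x. measure P {x} = 0" "integrable P (\<lambda>x. \<bar>x\<bar> powr p)"
        using af that by (auto simp: atom_free_moment_def)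
      interpret prob_space P by (rule a)
      show ?thesis by unfold_locales (use assms(1) K a p w in auto)
    qed
    have k: "\<kappa> \<in> borel_measurable (M P)" if "P \<in> \<P>" for P
      using MX that by (auto simp: indep_of_sample_def)
    note R0 = err_quantile_nonneg_tail(1)[OF _ k]
    define err_le where "err_le = (\<lambda>P \<epsilon> \<delta> \<omega>. \<forall>Y\<in>contaminated n \<epsilon> (\<lambda>i. X i \<omega>).
      \<forall>q\<in>{1<..min 2 p}. \<forall>q'\<in>{1<..p}.
        \<bar>mu_hat w (ln (4 / \<delta>) + (1 + \<xi>) * \<epsilon> * real n) n (\<kappa> \<omega>) Y - mean P\<bar> \<le> C0 *
          ((nu P q + nu P q powr (q / 2) * rpow (err_quantile (M P) \<kappa> (mean P) (\<delta> / 4)) (1 - q / 2)) *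
              (1 / real n * ln (4 / \<delta>)) powr (1 - 1 / q)
            + (nu P q' + err_quantile (M P) \<kappa> (mean P) (\<delta> / 4)) *
              (1 / real n * ln (4 / \<delta>) + \<epsilon>) powr (1 - 1 / q')))"
    have event: "\<exists>E\<in>sets (M P). 1 - \<delta> \<le> measure (M P) E \<and> (\<forall>\<omega>\<in>E. err_le P \<epsilon> \<delta> \<omega>)"
      if "P \<in> \<P>" "0 \<le> \<epsilon>" "0 < \<delta>" "\<delta> < 1"
        "(1 + 2 * \<xi>) * \<epsilon> + c_bar \<xi> / real n * ln (4 / \<delta>) \<le> 1" for P \<epsilon> \<delta>
    proof -
      have "prob_space (M P)" "iid_sample (M P) P n X" "indep_of_sample (M P) n \<kappa> X"
        using MX that by auto
      from shrinkage_moment.prob_mu_hat_bound[OF loc[OF that(1)] this n assms(3) that(2-5)]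
      show ?thesis unfolding prob_at_least_def C0_def err_le_def by blast
    qed
    {
      fix P and \<epsilon> \<delta> :: real
      assume P: "P \<in> \<P>" and \<epsilon>: "0 \<le> \<epsilon>" and \<delta>: "0 < \<delta>" "\<delta> < 1"
        and small: "(1 + 2 * \<xi>) * \<epsilon> + c_bar \<xi> / real n * ln (4 / \<delta>) < 1"
      have R: "0 \<le> err_quantile (M P) \<kappa> (mean P) (\<delta> / 4)"
        using R0[OF _ P] MX P \<delta> by simp
      obtain E where E: "E \<in> sets (M P)" "1 - \<delta> \<le> measure (M P) E" and sub: "\<forall>\<omega>\<in>E. err_le P \<epsilon> \<delta> \<omega>"
        using event[OF P \<epsilon> \<delta> less_imp_le[OF small]] by blast
      show "prob_at_least (M P) (1 - \<delta>)
           (\<lambda>\<omega>. \<forall>Y\<in>contaminated n \<epsilon> (\<lambda>i. X i \<omega>).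
              \<bar>mu_hat w (ln (4 / \<delta>) + (1 + \<xi>) * \<epsilon> * real n) n (\<kappa> \<omega>) Y - mean P\<bar>
                \<le> 2 * C0 * err_bound P p (err_quantile (M P) \<kappa> (mean P) (\<delta> / 4)) \<epsilon> n \<delta>)"
        unfolding prob_at_least_def
      proof (intro bexI[OF _ E(1)] conjI E(2) subsetI CollectI ballI)
        show "\<omega> \<in> space (M P)" if "\<omega> \<in> E" for \<omega>
          using that E sets.sets_into_space by blast
        fix \<omega> Y assume \<omega>: "\<omega> \<in> E" and Y: "Y \<in> contaminated n \<epsilon> (\<lambda>i. X i \<omega>)"
        have "\<bar>mu_hat w (ln (4 / \<delta>) + (1 + \<xi>) * \<epsilon> * real n) n (\<kappa> \<omega>) Y - mean P\<bar>
            \<le> C0 * err_bound P p (err_quantile (M P) \<kappa> (mean P) (\<delta> / 4)) \<epsilon> n \<delta>"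
          using sub \<omega> Y unfolding err_le_def by (intro le_err_bound[OF p C0]) blast
        also have "\<dots> \<le> 2 * C0 * err_bound P p (err_quantile (M P) \<kappa> (mean P) (\<delta> / 4)) \<epsilon> n \<delta>"
          using C0 err_bound_nonneg[OF p R] by (intro mult_right_mono) auto
        finally show "\<bar>mu_hat w (ln (4 / \<delta>) + (1 + \<xi>) * \<epsilon> * real n) n (\<kappa> \<omega>) Y - mean P\<bar>
            \<le> 2 * C0 * err_bound P p (err_quantile (M P) \<kappa> (mean P) (\<delta> / 4)) \<epsilon> n \<delta>" .
      qed
    }
    {
      fix C \<delta>min :: real and P and \<epsilon> \<delta> :: real
      assume C: "0 < C" and "0 < \<delta>min"
        and RC: "\<forall>q\<in>{min 2 p..p}. \<forall>\<delta>. \<delta>min \<le> \<delta> \<longrightarrow> \<delta> < 1 \<longrightarrow>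
            (\<forall>P\<in>\<P>. err_quantile (M P) \<kappa> (mean P) (\<delta> / 4) \<le> C * nu P q)"
        and P: "P \<in> \<P>" and \<epsilon>: "0 \<le> \<epsilon>" and \<delta>: "0 < \<delta>" "\<delta> < 1"
        and \<delta>ge: "max \<delta>min (4 * exp (- ((1 - (1 + 2 * \<xi>) * \<epsilon>) / c_bar \<xi> * real n))) \<le> \<delta>"
      define R where "R = err_quantile (M P) \<kappa> (mean P) (\<delta> / 4)"
      define l where "l = 1 / real n * ln (4 / \<delta>)"
      define r where "r = min 2 p"
      define bound where "bound = nu P r * l powr (1 - 1 / r) + nu P p * \<epsilon> powr (1 - 1 / p)"
      have R: "0 \<le> R" using R0[OF _ P] MX P \<delta> by (simp add: R_def)
      have Rle: "R \<le> C * nu P r" "R \<le> C * nu P p"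
        using RC \<delta>ge \<delta> P by (auto simp: R_def r_def)
      have r: "1 < r" "r \<le> 2" "r \<le> p" using p by (auto simp: r_def)
      have l: "0 \<le> l" using \<delta> by (simp add: l_def)
      have small: "(1 + 2 * \<xi>) * \<epsilon> + c_bar \<xi> / real n * ln (4 / \<delta>) \<le> 1"
      proof -
        have cb: "0 < c_bar \<xi>" using assms(3) by (simp add: c_bar_def add_pos_nonneg)
        have n0: "0 < real n" using n by simp
        define z where "z = (1 - (1 + 2 * \<xi>) * \<epsilon>) / c_bar \<xi> * real n"
        have "exp (- z) \<le> \<delta> / 4" using \<delta>ge by (simp add: z_def)
        then have "- z \<le> ln (\<delta> / 4)" using \<delta> by (simp add: ln_ge_iff)
        then have "ln (4 / \<delta>) \<le> z" using \<delta> by (simp add: ln_div)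
        then have "c_bar \<xi> / real n * ln (4 / \<delta>) \<le> c_bar \<xi> / real n * z"
          using cb n0 by (intro mult_left_mono) auto
        also have "\<dots> = 1 - (1 + 2 * \<xi>) * \<epsilon>" using cb n0 by (simp add: z_def)
        finally show ?thesis by simp
      qed
      obtain E where E: "E \<in> sets (M P)" "1 - \<delta> \<le> measure (M P) E" and sub: "\<forall>\<omega>\<in>E. err_le P \<epsilon> \<delta> \<omega>"
        using event[OF P \<epsilon> \<delta> small] by blast
      interpret M: prob_space "M P" using MX P by blast
      have nus: "0 \<le> nu P r" "0 \<le> nu P p" by (simp_all add: nu_def)
      have first: "(nu P r + nu P r powr (r / 2) * rpow R (1 - r / 2)) * l powr (1 - 1 / r)
          \<le> (2 + C) * (nu P r * l powr (1 - 1 / r))"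
        using mult_right_mono[OF interpolated_nu_le[OF nus(1) R Rle(1) C r(1,2)], of "l powr (1 - 1 / r)"]
        by simp
      have key: "\<exists>q'\<in>{1<..p}. C0 * ((nu P r + nu P r powr (r / 2) * rpow R (1 - r / 2)) * l powr (1 - 1 / r)
          + (nu P q' + R) * (l + \<epsilon>) powr (1 - 1 / q')) \<le> 2 * C0 * (2 * C + 3) * bound"
      proof -
        \<comment> \<open>The choice of \<open>q'\<close> depends on which summand of l + \<epsilon>
          dominates: r = min 2 p when \<epsilon> \<le> l, and p otherwise. Doubling the larger one
          then leaves a single term of \<open>bound\<close>.\<close>
        obtain q' Z where q': "q' \<in> {1<..p}" and Z: "(nu P q' + R) * (l + \<epsilon>) powr (1 - 1 / q') \<le> 2 * (1 + C) * Z"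
          and "0 \<le> Z" "Z \<le> bound" 
        proof (cases "\<epsilon> \<le> l")
          case True
          have "(nu P r + R) * (l + \<epsilon>) powr (1 - 1 / r) \<le> ((1 + C) * nu P r) * (2 * l powr (1 - 1 / r))"
            using True \<epsilon> l r Rle C nus R by (intro mult_mono double_powr_le) (auto simp: algebra_simps)
          then show ?thesis
            using r nus by (intro that[of r "nu P r * l powr (1 - 1 / r)"]) (auto simp: bound_def algebra_simps)
        next
          case False
          have "(nu P p + R) * (l + \<epsilon>) powr (1 - 1 / p) \<le> ((1 + C) * nu P p) * (2 * \<epsilon> powr (1 - 1 / p))"
            using False \<epsilon> l p Rle C nus R by (intro mult_mono double_powr_le) (auto simp: algebra_simps)
          then show ?thesis
            using p nus by (intro that[of p "nu P p * \<epsilon> powr (1 - 1 / p)"]) (auto simp: bound_def algebra_simps)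
        qed
        have "nu P r * l powr (1 - 1 / r) \<le> bound" using nus by (simp add: bound_def)
        then have "(2 + C) * (nu P r * l powr (1 - 1 / r)) \<le> (2 + C) * bound"
          using C by (intro mult_left_mono) auto
        moreover have "2 * (1 + C) * Z \<le> 2 * (1 + C) * bound"
          using C \<open>Z \<le> bound\<close> by (intro mult_left_mono) auto
        moreover have "0 \<le> bound" "0 \<le> C * bound" using \<open>0 \<le> Z\<close> \<open>Z \<le> bound\<close> C by auto
        \<comment> \<open>The coefficients add up to (2 + C) + 2 (1 + C) = 3 C + 4 \<le> 2 (2 C +
          3).\<close>
        ultimately have "(nu P r + nu P r powr (r / 2) * rpow R (1 - r / 2)) * l powr (1 - 1 / r)
          + (nu P q' + R) * (l + \<epsilon>) powr (1 - 1 / q') \<le> 2 * (2 * C + 3) * bound"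
          using first Z by (simp add: algebra_simps)
        then have "C0 * ((nu P r + nu P r powr (r / 2) * rpow R (1 - r / 2)) * l powr (1 - 1 / r)
          + (nu P q' + R) * (l + \<epsilon>) powr (1 - 1 / q')) \<le> C0 * (2 * (2 * C + 3) * bound)"
          using C0 by (intro mult_left_mono) auto
        then show ?thesis using q' by (auto simp: mult_ac)
      qed
      have "\<bar>mu_hat w (ln (4 / \<delta>) + (1 + \<xi>) * \<epsilon> * real n) n (\<kappa> \<omega>) Y - mean P\<bar> \<le> 2 * C0 * (2 * C + 3) * bound"
        if "\<omega> \<in> E" "Y \<in> contaminated n \<epsilon> (\<lambda>i. X i \<omega>)" for \<omega> Y
      proof -
        obtain q' where q': "q' \<in> {1<..p}" and
          le: "C0 * ((nu P r + nu P r powr (r / 2) * rpow R (1 - r / 2)) * l powr (1 - 1 / r)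
          + (nu P q' + R) * (l + \<epsilon>) powr (1 - 1 / q')) \<le> 2 * C0 * (2 * C + 3) * bound"
          using key by blast
        have "r \<in> {1<..min 2 p}" using r by simp
        then have "\<bar>mu_hat w (ln (4 / \<delta>) + (1 + \<xi>) * \<epsilon> * real n) n (\<kappa> \<omega>) Y - mean P\<bar>
          \<le> C0 * ((nu P r + nu P r powr (r / 2) * rpow R (1 - r / 2)) * l powr (1 - 1 / r)
          + (nu P q' + R) * (l + \<epsilon>) powr (1 - 1 / q'))"
          using sub that q' unfolding err_le_def R_def l_def by blast
        with le show ?thesis by linarith
      qed
      \<comment> \<open>A supremum above the bound would require one contaminated sample above it,
        which \<open>E\<close> excludes. The complement of \<open>E\<close> is thus a measurable
        cover of the bad outcomes.\<close>
      then have "E \<inter> {\<omega> \<in> space (M P). (SUP Y\<in>contaminated n \<epsilon> (\<lambda>i. X i \<omega>).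
          ereal \<bar>mu_hat w (ln (4 / \<delta>) + (1 + \<xi>) * \<epsilon> * real n) n (\<kappa> \<omega>) Y - mean P\<bar>)
          > ereal (2 * C0 * (2 * C + 3) * bound)} = {}"
        by (auto simp: less_SUP_iff) (meson not_less)
      moreover have "measure (M P) (space (M P) - E) \<le> \<delta>"
        using E by (simp add: M.prob_compl)
      ultimately show "prob_at_most (M P) \<delta>
              (\<lambda>\<omega>. (SUP Y\<in>contaminated n \<epsilon> (\<lambda>i. X i \<omega>).
                  ereal \<bar>mu_hat w (ln (4 / \<delta>) + (1 + \<xi>) * \<epsilon> * real n) n (\<kappa> \<omega>) Y - mean P\<bar>)
                > ereal (2 * C0 * (2 * C + 3) *
                    (nu P (min 2 p) * (1 / real n * ln (4 / \<delta>)) powr (1 - 1 / min 2 p)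
                     + nu P p * \<epsilon> powr (1 - 1 / p))))"
        unfolding prob_at_most_def bound_def l_def r_def
        using E by (intro bexI[of _ "space (M P) - E"]) auto
    }
  qed
qed

end
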